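(* Let $G_1$ and $G_2$ be finite, simple, connected, undirected graphs with $n\ge 2$ and $m\ge 2$ vertices respectively, with a vertex $v_1$ marked in $G_1$ and a vertex $v_2$ marked in $G_2$. Let $H$ be the graph obtained by taking the disjoint union of $G_1$ and $G_2$, removing the vertices $v_1$ and $v_2$ (with all edges incident to them), and then adding all edges between $N_{G_1}(v_1)$ and $N_{G_2}(v_2)$. Let $x_1,\dots,x_n$ be the variables corresponding to the vertices of $G_1$, with $x_n$ corresponding to $v_1$, and let $y_1,\dots,y_m$ be the variables corresponding to the vertices of $G_2$, with $y_m$ corresponding to $v_2$; the vertices of $H$ keep their variables $x_1,\dots,x_{n-1},y_1,\dots,y_{m-1}$. Then $$P_H(x_1,\dots,x_{n-1},y_1,\dots,y_{m-1}) = P_{G_1}\Bigl(x_1,\dots,x_{n-1},\sum_{i\in N_{G_2}(v_2)} y_i\Bigr)\cdot P_{G_2}\Bigl(y_1,\dots,y_{m-1},\sum_{i\in N_{G_1}(v_1)} x_i\Bigr),$$ where $i\in N_{G_2}(v_2)$ (respectively $i\in N_{G_1}(v_1)$) means that $i$ runs over the indices of the vertices in that neighborhood.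
   Context: For a graph $G=(V,E)$ and $v\in V$, $N_G(v)=\{u\in V: vu\in E\}$ is the neighborhood of $v$. $\mathcal S(G)$ is the set of all spanning trees of $G$. Assigning a variable $x_v$ to every vertex $v$, the vertex spanning (degree) enumerator of $G$ is $$P_G=\sum_{T\in\mathcal S(G)}\ \prod_{v\in V} x_v^{\deg_T(v)-1},$$ where $\deg_T(v)$ is the degree of $v$ in the tree $T$. It is a polynomial when $G$ has at least two vertices. *)

theory Defs
  imports "HOL-Library.Poly_Mapping"
begin

section \<open>Undirected graphs and spanning trees\<close>

record 'a ugraph =
  verts :: "'a set"
  edges :: "'a set set"

definition finite_simple_graph :: "'a ugraph \<Rightarrow> bool" where
  "finite_simple_graph G \<longleftrightarrow>
     finite (verts G) \<and> (\<forall>e\<in>edges G. e \<subseteq> verts G \<and> card e = 2)"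

definition neighborhood :: "'a ugraph \<Rightarrow> 'a \<Rightarrow> 'a set" where
  "neighborhood G v = {u \<in> verts G. {v, u} \<in> edges G}"

definition vdegree :: "'a ugraph \<Rightarrow> 'a \<Rightarrow> nat" where
  "vdegree G v = card {e \<in> edges G. v \<in> e}"

definition connected_graph :: "'a ugraph \<Rightarrow> bool" where
  "connected_graph G \<longleftrightarrow> verts G \<noteq> {} \<and>
     (\<forall>u\<in>verts G. \<forall>v\<in>verts G. (u, v) \<in> {(a, b). {a, b} \<in> edges G}\<^sup>*)"

text \<open>A cycle is given by its list of pairwise distinct vertices, closing up from the
  last vertex to the first one.\<close>

definition graph_cycle :: "'a ugraph \<Rightarrow> 'a list \<Rightarrow> bool" where
  "graph_cycle G c \<longleftrightarrow> 3 \<le> length c \<and> distinct c \<and> set c \<subseteq> verts G \<and>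
     (\<forall>i<length c. {c ! i, c ! (Suc i mod length c)} \<in> edges G)"

definition tree_graph :: "'a ugraph \<Rightarrow> bool" where
  "tree_graph T \<longleftrightarrow> connected_graph T \<and> (\<nexists>c. graph_cycle T c)"

definition spanning_trees :: "'a ugraph \<Rightarrow> 'a ugraph set" where
  "spanning_trees G = {T. verts T = verts G \<and> edges T \<subseteq> edges G \<and> tree_graph T}"

lemma finite_spanning_trees:
  assumes "finite_simple_graph G"
  shows "finite (spanning_trees G)"
proof -
  have "edges G \<subseteq> Pow (verts G)"
    using assms by (auto simp: finite_simple_graph_def)
  then have "finite (edges G)"
    using assms by (meson finite_Pow_iff finite_simple_graph_def finite_subset)
  then have "finite ((\<lambda>F. \<lparr>verts = verts G, edges = F\<rparr>) ` Pow (edges G))"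
    by simp
  moreover have "spanning_trees G \<subseteq> (\<lambda>F. \<lparr>verts = verts G, edges = F\<rparr>) ` Pow (edges G)"
  proof
    fix T assume "T \<in> spanning_trees G"
    then have "T = \<lparr>verts = verts G, edges = edges T\<rparr>" "edges T \<in> Pow (edges G)"
      by (auto simp: spanning_trees_def)
    then show "T \<in> (\<lambda>F. \<lparr>verts = verts G, edges = F\<rparr>) ` Pow (edges G)"
      by blast
  qed
  ultimately show ?thesis
    by (rule finite_subset[rotated])
qed


section \<open>Joining two marked graphs along neighborhoods\<close>

definition disjoint_union :: "'a ugraph \<Rightarrow> 'b ugraph \<Rightarrow> ('a + 'b) ugraph" where
  "disjoint_union G\<^sub>1 G\<^sub>2 =
     \<lparr>verts = verts G\<^sub>1 <+> verts G\<^sub>2,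
      edges = (\<lambda>e. Inl ` e) ` edges G\<^sub>1 \<union> (\<lambda>e. Inr ` e) ` edges G\<^sub>2\<rparr>"

definition remove_verts :: "'a ugraph \<Rightarrow> 'a set \<Rightarrow> 'a ugraph" where
  "remove_verts G W = \<lparr>verts = verts G - W, edges = {e \<in> edges G. e \<inter> W = {}}\<rparr>"

definition add_edges :: "'a ugraph \<Rightarrow> 'a set set \<Rightarrow> 'a ugraph" where
  "add_edges G F = \<lparr>verts = verts G, edges = edges G \<union> F\<rparr>"

definition neighborhood_join :: "'a ugraph \<Rightarrow> 'a \<Rightarrow> 'b ugraph \<Rightarrow> 'b \<Rightarrow> ('a + 'b) ugraph" where
  "neighborhood_join G\<^sub>1 v\<^sub>1 G\<^sub>2 v\<^sub>2 =
     add_edges (remove_verts (disjoint_union G\<^sub>1 G\<^sub>2) {Inl v\<^sub>1, Inr v\<^sub>2})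
       {{Inl a, Inr b} | a b. a \<in> neighborhood G\<^sub>1 v\<^sub>1 \<and> b \<in> neighborhood G\<^sub>2 v\<^sub>2}"

lemma finite_simple_graph_neighborhood_join:
  assumes "finite_simple_graph G\<^sub>1" "finite_simple_graph G\<^sub>2"
  shows "finite_simple_graph (neighborhood_join G\<^sub>1 v\<^sub>1 G\<^sub>2 v\<^sub>2)"
proof -
  have no_loop: "{v} \<notin> edges G\<^sub>1" "{w} \<notin> edges G\<^sub>2" for v w
    using assms by (auto simp: finite_simple_graph_def)
  have "card (Inl ` e :: ('a + 'b) set) = card e" "card (Inr ` f :: ('a + 'b) set) = card f" for e f
    by (simp_all add: card_image)
  then show ?thesis
    using assms no_loop
    by (fastforce simp: finite_simple_graph_def neighborhood_join_def add_edges_def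
        remove_verts_def disjoint_union_def neighborhood_def)
qed


section \<open>Multivariate polynomials\<close>

text \<open>Integer polynomials in variables indexed by \<^typ>\<open>'v\<close>: a monomial is a finitely supported
  exponent function, and the ring operations are those of the monoid algebra
  of the monomials.\<close>

type_synonym 'v mpoly = "('v \<Rightarrow>\<^sub>0 nat) \<Rightarrow>\<^sub>0 int"

definition mvar :: "'v \<Rightarrow> 'v mpoly" where
  "mvar v = Poly_Mapping.single (Poly_Mapping.single v 1) 1"

text \<open>Simultaneous substitution of the polynomial \<open>\<sigma> v\<close> for every variable \<open>v\<close>.\<close>

definition mpoly_subst :: "('v \<Rightarrow> 'w mpoly) \<Rightarrow> 'v mpoly \<Rightarrow> 'w mpoly" where
  "mpoly_subst \<sigma> p =
     (\<Sum>m\<in>Poly_Mapping.keys p. of_int (Poly_Mapping.lookup p m) *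
        (\<Prod>v\<in>Poly_Mapping.keys m. \<sigma> v ^ Poly_Mapping.lookup m v))"

lemma mpoly_subst_mvar: "mpoly_subst \<sigma> (mvar v) = \<sigma> v"
  by (simp add: mpoly_subst_def mvar_def)


section \<open>The vertex spanning enumerator\<close>

text \<open>If \<open>G\<close> has at least two vertices, then every vertex has positive degree in every spanning
  tree, so the truncated subtraction in the exponent is the true one.  (For a one-vertex graph
  the enumerator would be the non-polynomial \<open>x\<^sub>v\<close> to the power \<open>-1\<close>, and the definition below is
  not meaningful.)\<close>

definition spanning_enumerator :: "'a ugraph \<Rightarrow> 'a mpoly" where
  "spanning_enumerator G =
     (\<Sum>T\<in>spanning_trees G. \<Prod>v\<in>verts G. mvar v ^ (vdegree T v - 1))"

end

theory Submission
  imports Defs "HOL-Library.FuncSet"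
begin

text \<open>
  A spanning tree rooted at \<open>r\<close> is the same as an acyclic parent function, so \<open>x\<^sub>r P\<^sub>G\<close> is the sum
  of \<open>\<Prod>\<^sub>v x\<^bsub>f v\<^esub>\<close> over the acyclic parent functions \<open>f\<close> with root \<open>r\<close>. Let \<open>S\<^sub>A\<close> and \<open>S\<^sub>B\<close> be the sums of
  the variables in \<open>A = N(v\<^sub>1)\<close> and \<open>B = N(v\<^sub>2)\<close>. Rooting \<open>H\<close> at all \<open>r \<in> A\<close> and letting \<open>r\<close> point
  anywhere into \<open>B\<close>, \<open>S\<^sub>A S\<^sub>B P\<^sub>H\<close> sums over self-maps \<open>g\<close> of \<open>H\<close> with a marked jump \<open>r \<mapsto> g r\<close> from
  \<open>A\<close> to \<open>B\<close> whose removal makes \<open>g\<close> acyclic. Rooting \<open>G\<^sub>1\<close> at \<open>v\<^sub>1\<close> and \<open>G\<^sub>2\<close> at \<open>v\<^sub>2\<close> and expanding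
  the substituted sums, the right-hand side times \<open>S\<^sub>A S\<^sub>B\<close> sums over self-maps of \<open>H\<close> that have no
  cycle inside \<open>G\<^sub>1 - v\<^sub>1\<close> or inside \<open>G\<^sub>2 - v\<^sub>2\<close>, i.e.\ that become acyclic once all jumps from \<open>A\<close> to
  \<open>B\<close> are removed. For a fixed set \<open>J\<close> of jumping vertices and fixed values off \<open>J\<close>, summing over the
  jump targets gives \<open>S\<^sub>B\<close> to the power \<open>|J|\<close> in both cases. Finally \<open>S\<^sub>A\<close> and \<open>S\<^sub>B\<close> are cancelled.
\<close>

section \<open>Multivariate polynomials\<close>

lemma keys_mvar_mult: "Poly_Mapping.keys (mvar v * p) \<subseteq> (\<lambda>m. Poly_Mapping.single v 1 + m) ` Poly_Mapping.keys p"
  using keys_mult[of "mvar v" p] by (auto simp: mvar_def)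

lemma lookup_mvar_mult:
  "Poly_Mapping.lookup (mvar v * p) (Poly_Mapping.single v 1 + m) = Poly_Mapping.lookup p m"
proof -
  let ?s = "Poly_Mapping.single v (1::nat)"
  have "Poly_Mapping.lookup (mvar v) a * x = (x when a = ?s)" for a and x :: int
    by (simp add: mvar_def lookup_single when_def)
  then show ?thesis
    by (simp add: lookup_mult)
qed

text \<open>Fix \<open>v\<close> in \<open>I\<close> and a monomial \<open>m\<close> of
  \<open>p\<close> whose exponent \<open>d\<close> in \<open>v\<close> is maximal. Multiplying
  \<open>m\<close> by the variable \<open>v\<close> gives a monomial \<open>k\<close> with exponent
  \<open>d + 1\<close> in \<open>v\<close>, which cannot occur in \<open>mvar u * p\<close> for
  \<open>u \<noteq> v\<close>. Its coefficient in the product is therefore the nonzero coefficient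
  of \<open>m\<close> in \<open>p\<close>.\<close>

lemma sum_mvar_mult_eq_0:
  fixes p :: "'v mpoly"
  assumes "finite I" "I \<noteq> {}" "(\<Sum>i\<in>I. mvar i) * p = 0"
  shows "p = 0"
proof (rule ccontr)
  assume "p \<noteq> 0"
  then have ne: "Poly_Mapping.keys p \<noteq> {}"
    by simp
  obtain v where v: "v \<in> I"
    using assms(2) by blast
  define d where "d = Max ((\<lambda>m. Poly_Mapping.lookup m v) ` Poly_Mapping.keys p)"
  have "d \<in> (\<lambda>m. Poly_Mapping.lookup m v) ` Poly_Mapping.keys p"
    unfolding d_def using ne by (intro Max_in) auto
  then obtain m where m: "m \<in> Poly_Mapping.keys p" "Poly_Mapping.lookup m v = d"
    by auto
  have le: "Poly_Mapping.lookup b v \<le> d" if "b \<in> Poly_Mapping.keys p" for b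
    unfolding d_def using that by (intro Max_ge) auto
  define k where "k = Poly_Mapping.single v 1 + m"
  have "Poly_Mapping.lookup (mvar u * p) k = 0" if "u \<noteq> v" for u
  proof (rule ccontr)
    assume "Poly_Mapping.lookup (mvar u * p) k \<noteq> 0"
    then obtain b where b: "b \<in> Poly_Mapping.keys p" "k = Poly_Mapping.single u 1 + b"
      using keys_mvar_mult[of u p] by (auto simp: in_keys_iff)
    have "Poly_Mapping.lookup k v = Poly_Mapping.lookup b v"
      using that by (simp add: b lookup_add lookup_single)
    moreover have "Poly_Mapping.lookup k v = Suc d"
      by (simp add: k_def lookup_add m)
    ultimately show False
      using le[OF b(1)] by simp
  qed
  then have "(\<Sum>u\<in>I - {v}. Poly_Mapping.lookup (mvar u * p) k) = 0"
    by (intro sum.neutral) auto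
  then have "Poly_Mapping.lookup ((\<Sum>i\<in>I. mvar i) * p) k = Poly_Mapping.lookup (mvar v * p) k"
    unfolding sum_distrib_right lookup_sum by (subst sum.remove[OF assms(1) v]) simp
  also have "\<dots> \<noteq> 0"
    unfolding k_def lookup_mvar_mult using m(1) by (simp add: in_keys_iff)
  finally show False
    by (simp add: assms(3))
qed

lemma sum_mvar_mult_cancel:
  fixes p q :: "'v mpoly"
  assumes "finite I" "I \<noteq> {}" "(\<Sum>i\<in>I. mvar i) * p = (\<Sum>i\<in>I. mvar i) * q"
  shows "p = q"
  using sum_mvar_mult_eq_0[of I "p - q"] assms by (simp add: right_diff_distrib)

section \<open>Evaluating a substitution on a sum of monomials\<close>

text \<open>The defining sum runs over the keys of \<open>p\<close>, which differ between
  \<open>p\<close>, \<open>q\<close> and \<open>p + q\<close>. A common index set makes additivity a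
  termwise fact.\<close>

lemma mpoly_subst_superset:
  assumes "finite K" "Poly_Mapping.keys p \<subseteq> K"
  shows "mpoly_subst \<sigma> p = (\<Sum>m\<in>K. of_int (Poly_Mapping.lookup p m) *
    (\<Prod>v\<in>Poly_Mapping.keys m. \<sigma> v ^ Poly_Mapping.lookup m v))"
  unfolding mpoly_subst_def
  by (rule sum.mono_neutral_left) (use assms in \<open>auto simp: in_keys_iff\<close>)

lemma mpoly_subst_add: "mpoly_subst \<sigma> (p + q) = mpoly_subst \<sigma> p + mpoly_subst \<sigma> q"
proof -
  let ?K = "Poly_Mapping.keys p \<union> Poly_Mapping.keys q"
  have "finite ?K" "Poly_Mapping.keys (p + q) \<subseteq> ?K"
    using keys_add[of p q] by auto
  then show ?thesis
    by (simp add: mpoly_subst_superset[of ?K] lookup_add distrib_right sum.distrib)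
qed

lemma mpoly_subst_sum: "mpoly_subst \<sigma> (\<Sum>i\<in>I. p i) = (\<Sum>i\<in>I. mpoly_subst \<sigma> (p i))"
proof (induction I rule: infinite_finite_induct)
  case (insert i I)
  then show ?case by (simp add: mpoly_subst_add)
qed (simp_all add: mpoly_subst_def)

lemma mvar_power: "mvar v ^ k = Poly_Mapping.single (Poly_Mapping.single v k) 1"
  by (induction k) (simp_all add: mvar_def mult_single flip: single_add)

lemma prod_mvar_power:
  "(\<Prod>v\<in>V. mvar v ^ k v) = Poly_Mapping.single (\<Sum>v\<in>V. Poly_Mapping.single v (k v)) 1"
  by (induction V rule: infinite_finite_induct) (simp_all add: mvar_power mult_single)

text \<open>The summands of the enumerator are monomials of this shape, so together with additivity
  this evaluates every substitution into it.\<close>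

lemma mpoly_subst_prod_mvar_power:
  assumes "finite V"
  shows "mpoly_subst \<sigma> (\<Prod>v\<in>V. mvar v ^ k v) = (\<Prod>v\<in>V. \<sigma> v ^ k v)"
proof -
  let ?m = "\<Sum>v\<in>V. Poly_Mapping.single v (k v)"
  have lookup: "Poly_Mapping.lookup ?m v = (if v \<in> V then k v else 0)" for v
    using assms by (auto simp: lookup_sum lookup_single when_def)
  have "(\<Prod>v\<in>Poly_Mapping.keys ?m. \<sigma> v ^ Poly_Mapping.lookup ?m v) =
      (\<Prod>v\<in>V. \<sigma> v ^ Poly_Mapping.lookup ?m v)"
    by (rule prod.mono_neutral_left) (use assms in \<open>auto simp: in_keys_iff lookup split: if_splits\<close>)
  also have "\<dots> = (\<Prod>v\<in>V. \<sigma> v ^ k v)"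
    by (simp add: lookup)
  finally show ?thesis
    by (simp add: prod_mvar_power mpoly_subst_def)
qed


section \<open>Acyclic self-maps\<close>

text \<open>Values outside \<open>N\<close> are allowed and count as exits. The condition says that
  every orbit leaves \<open>N\<close>; for finite \<open>N\<close> this is the absence of cycles
  inside \<open>N\<close>. In terms of invariant sets, contraction and restriction reduce to
  checking which sets are invariant.\<close>

definition acyclic_on :: "'a set \<Rightarrow> ('a \<Rightarrow> 'a) \<Rightarrow> bool" where
  "acyclic_on N f \<longleftrightarrow> (\<forall>S\<subseteq>N. S \<noteq> {} \<longrightarrow> (\<exists>v\<in>S. f v \<notin> S))"

lemma acyclic_onD: "acyclic_on N f \<Longrightarrow> S \<subseteq> N \<Longrightarrow> (\<And>v. v \<in> S \<Longrightarrow> f v \<in> S) \<Longrightarrow> S = {}"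
  unfolding acyclic_on_def by blast

lemma acyclic_onI: "(\<And>S. S \<subseteq> N \<Longrightarrow> S \<noteq> {} \<Longrightarrow> (\<And>v. v \<in> S \<Longrightarrow> f v \<in> S) \<Longrightarrow> False) \<Longrightarrow> acyclic_on N f"
  unfolding acyclic_on_def by blast

lemma acyclic_on_subset: "acyclic_on N f \<Longrightarrow> M \<subseteq> N \<Longrightarrow> acyclic_on M f"
  unfolding acyclic_on_def by (meson subset_trans)

lemma acyclic_on_cong:
  assumes "\<And>v. v \<in> N \<Longrightarrow> f v = g v"
  shows "acyclic_on N f \<longleftrightarrow> acyclic_on N g"
  unfolding acyclic_on_def by (metis assms subsetD)

text \<open>Contraction of \<open>v\<close> into \<open>f v\<close>. A set invariant under the
  redirected map is invariant under \<open>f\<close>, after adding \<open>v\<close> if some point of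
  it maps to \<open>v\<close>. Conversely, an \<open>f\<close>-invariant set stays invariant under
  the redirected map when \<open>v\<close> is removed, because
  \<open>f v \<noteq> v\<close>.\<close>

lemma acyclic_on_insert:
  assumes "v \<notin> N"
  shows "acyclic_on (insert v N) f \<longleftrightarrow>
    f v \<noteq> v \<and> acyclic_on N (\<lambda>u. if f u = v then f v else f u)" (is "_ \<longleftrightarrow> _ \<and> acyclic_on N ?f")
proof (intro iffI conjI)
  assume ac: "acyclic_on (insert v N) f"
  show "f v \<noteq> v"
    using acyclic_onD[OF ac, of "{v}"] by auto
  show "acyclic_on N ?f"
  proof (rule acyclic_onI)
    fix S assume S: "S \<subseteq> N" "S \<noteq> {}" and closed: "\<And>u. u \<in> S \<Longrightarrow> ?f u \<in> S"
    show False
    proof (cases "\<exists>u\<in>S. f u = v")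
      case True
      then have "f v \<in> S" using closed by force
      then have "insert v S = {}"
        using S closed by (intro acyclic_onD[OF ac]) (auto split: if_splits, metis)
      then show False by simp
    next
      case False
      have "S = {}"
      proof (intro acyclic_onD[OF ac])
        show "f u \<in> S" if "u \<in> S" for u
          using closed[OF that] False that by auto
      qed (use S in auto)
      then show False using S by simp
    qed
  qed
next
  assume *: "f v \<noteq> v \<and> acyclic_on N ?f"
  show "acyclic_on (insert v N) f"
  proof (rule acyclic_onI)
    fix S assume S: "S \<subseteq> insert v N" "S \<noteq> {}" and closed: "\<And>u. u \<in> S \<Longrightarrow> f u \<in> S"
    have "S - {v} = {}"
    proof (rule acyclic_onD)
      show "acyclic_on N ?f" using * by blast
      show "?f u \<in> S - {v}" if "u \<in> S - {v}" for u
        using that closed * by auto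
    qed (use S in auto)
    then have "S = {v}" using S by auto
    then show False using closed * by auto
  qed
qed

section \<open>Sums over function spaces and a weighted count of acyclic labellings\<close>

lemma sum_PiE_Un:
  fixes F :: "('a \<Rightarrow> 'b) \<Rightarrow> 'c::comm_monoid_add"
  assumes "A \<inter> B = {}"
  shows "(\<Sum>g\<in>PiE (A \<union> B) T. F g) =
    (\<Sum>h\<in>PiE A T. \<Sum>f\<in>PiE B T. F (\<lambda>x. if x \<in> A then h x else f x))"
proof -
  have "(\<Sum>g\<in>PiE (A \<union> B) T. F g) =
      (\<Sum>(h, f)\<in>PiE A T \<times> PiE B T. F (\<lambda>x. if x \<in> A then h x else f x))"
    by (rule sum.reindex_bij_witness[of _ "\<lambda>(h, f). \<lambda>x. if x \<in> A then h x else f x"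
          "\<lambda>g. (restrict g A, restrict g B)"])
      (use assms in \<open>auto simp: PiE_iff extensional_def restrict_def fun_eq_iff split: if_splits
        intro!: arg_cong[of _ _ F]\<close>)
  then show ?thesis
    by (simp add: sum.cartesian_product)
qed

lemma sum_PiE_insert:
  fixes F :: "('a \<Rightarrow> 'b) \<Rightarrow> 'c::comm_monoid_add"
  assumes "a \<notin> A"
  shows "(\<Sum>g\<in>PiE (insert a A) T. F g) = (\<Sum>c\<in>T a. \<Sum>f\<in>PiE A T. F (f(a := c)))"
proof -
  have "(\<Sum>g\<in>PiE (insert a A) T. F g) = (\<Sum>(c, f)\<in>T a \<times> PiE A T. F (f(a := c)))"
    unfolding PiE_insert_eq
    by (subst sum.reindex) (use inj_combinator[OF assms, of T] in \<open>simp_all add: split_def comp_def\<close>)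
  then show ?thesis
    by (simp add: sum.cartesian_product)
qed

text \<open>The induction contracts \<open>v\<close> into the vertex \<open>\<pi> c\<close> that it points to, i.e.\ it
  redirects all labels of \<open>v\<close> to \<open>\<pi> c\<close>.\<close>

lemma sum_acyclic_labellings:
  fixes q :: "'c \<Rightarrow> 'r::comm_ring_1" and \<pi> :: "'c \<Rightarrow> 'a"
  assumes "finite N" "finite C" "s \<notin> N" "\<pi> ` C \<subseteq> insert s N"
  shows "(\<Sum>f\<in>N \<rightarrow>\<^sub>E C. if acyclic_on N (\<lambda>i. \<pi> (f i)) then \<Prod>i\<in>N. q (f i) else 0) * sum q C =
    sum q {c \<in> C. \<pi> c = s} * sum q C ^ card N"
  using assms(1,3,4)
proof (induction N arbitrary: \<pi> rule: finite_induct)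
  \<comment> \<open>Every label points to \<open>s\<close>, so both sides are
    \<open>sum q C\<close>. Without the extra factor on the left, this weighted Cayley formula would
    carry the exponent \<open>card N - 1\<close>, which fails for empty \<open>N\<close>.\<close>
  case empty
  then have "{c \<in> C. \<pi> c = s} = C"
    by auto
  then show ?case
    by (simp add: acyclic_on_def)
next
  case (insert v N)
  note [simp] = \<open>v \<notin> N\<close>
  define Q where "Q = sum q C"
  define \<rho> where "\<rho> c = (\<lambda>d. if \<pi> d = v then \<pi> c else \<pi> d)" for c
  define Z where "Z \<pi>' = (\<Sum>f\<in>N \<rightarrow>\<^sub>E C. if acyclic_on N (\<lambda>i. \<pi>' (f i)) then \<Prod>i\<in>N. q (f i) else 0)"
    for \<pi>' :: "'c \<Rightarrow> 'a"
  define C\<^sub>v where "C\<^sub>v = {c \<in> C. \<pi> c = v}"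
  define C\<^sub>s where "C\<^sub>s = {c \<in> C. \<pi> c = s}"
  have "(\<Sum>f\<in>insert v N \<rightarrow>\<^sub>E C. if acyclic_on (insert v N) (\<lambda>i. \<pi> (f i))
        then \<Prod>i\<in>insert v N. q (f i) else 0) =
      (\<Sum>c\<in>C. \<Sum>f\<in>N \<rightarrow>\<^sub>E C. if acyclic_on (insert v N) (\<lambda>i. \<pi> ((f(v := c)) i))
        then \<Prod>i\<in>insert v N. q ((f(v := c)) i) else 0)"
    by (rule sum_PiE_insert) simp
  also have "\<dots> = (\<Sum>c\<in>C. if \<pi> c = v then 0 else q c * Z (\<rho> c))"
  proof (rule sum.cong[OF refl])
    fix c assume "c \<in> C"
    have "acyclic_on (insert v N) (\<lambda>i. \<pi> ((f(v := c)) i)) \<longleftrightarrow>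
        \<pi> c \<noteq> v \<and> acyclic_on N (\<lambda>i. \<rho> c (f i))" for f
    proof -
      have "acyclic_on N (\<lambda>u. if \<pi> ((f(v := c)) u) = v then \<pi> ((f(v := c)) v) else \<pi> ((f(v := c)) u))
          \<longleftrightarrow> acyclic_on N (\<lambda>i. \<rho> c (f i))"
        proof (rule acyclic_on_cong)
        fix i assume "i \<in> N"
        then have "i \<noteq> v" by auto
        then show "(if \<pi> ((f(v := c)) i) = v then \<pi> ((f(v := c)) v) else \<pi> ((f(v := c)) i)) = \<rho> c (f i)"
          by (simp add: \<rho>_def)
      qed
      then show ?thesis
        by (subst acyclic_on_insert) simp_all
    qed
    moreover have "(\<Prod>i\<in>insert v N. q ((f(v := c)) i)) = q c * (\<Prod>i\<in>N. q (f i))" for f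
    proof -
      have "(\<Prod>i\<in>N. q ((f(v := c)) i)) = (\<Prod>i\<in>N. q (f i))"
        by (rule prod.cong) (use insert.hyps in auto)
      then show ?thesis
        using insert.hyps by simp
    qed
    ultimately show "(\<Sum>f\<in>N \<rightarrow>\<^sub>E C. if acyclic_on (insert v N) (\<lambda>i. \<pi> ((f(v := c)) i))
        then \<Prod>i\<in>insert v N. q ((f(v := c)) i) else 0) = (if \<pi> c = v then 0 else q c * Z (\<rho> c))"
      by (auto simp: Z_def sum_distrib_left intro!: sum.cong)
  qed
  finally have "(\<Sum>f\<in>insert v N \<rightarrow>\<^sub>E C. if acyclic_on (insert v N) (\<lambda>i. \<pi> (f i))
        then \<Prod>i\<in>insert v N. q (f i) else 0) * Q =
      (\<Sum>c\<in>C. if \<pi> c = v then 0 else q c * (Z (\<rho> c) * Q))"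
    by (auto simp: sum_distrib_right mult.assoc intro!: sum.cong)
  also have "\<dots> = (\<Sum>c\<in>C. (if \<pi> c = v then 0 else q c * sum q C\<^sub>s) +
      (if \<pi> c = s then q c * sum q C\<^sub>v else 0)) * Q ^ card N"
    unfolding sum_distrib_right
  proof (rule sum.cong[OF refl])
    fix c assume c: "c \<in> C"
    have "q c * (Z (\<rho> c) * Q) = (q c * sum q C\<^sub>s + (if \<pi> c = s then q c * sum q C\<^sub>v else 0)) * Q ^ card N"
      if "\<pi> c \<noteq> v"
    proof -
      have "Z (\<rho> c) * Q = sum q {d \<in> C. \<rho> c d = s} * Q ^ card N"
        unfolding Z_def Q_def using insert.prems that c by (intro insert.IH) (auto simp: \<rho>_def)
      \<comment> \<open>The contraction moves the labels of \<open>v\<close> to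
        \<open>\<pi> c\<close>, so they join the fibre over \<open>s\<close> exactly when
        \<open>\<pi> c = s\<close>.\<close>
      moreover have "{d \<in> C. \<rho> c d = s} = (if \<pi> c = s then C\<^sub>s \<union> C\<^sub>v else C\<^sub>s)"
        using insert.prems by (auto simp: \<rho>_def C\<^sub>v_def C\<^sub>s_def)
      moreover have "sum q (C\<^sub>s \<union> C\<^sub>v) = sum q C\<^sub>s + sum q C\<^sub>v"
        by (rule sum.union_disjoint) (use insert.prems assms(2) in \<open>auto simp: C\<^sub>v_def C\<^sub>s_def\<close>)
      ultimately show ?thesis
        by (simp add: algebra_simps)
    qed
    then show "(if \<pi> c = v then 0 else q c * (Z (\<rho> c) * Q)) =
        ((if \<pi> c = v then 0 else q c * sum q C\<^sub>s) + (if \<pi> c = s then q c * sum q C\<^sub>v else 0)) * Q ^ card N"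
      using insert.prems by auto
  qed
  \<comment> \<open>The first summands give \<open>sum q C\<^sub>s\<close> times the weight of the
    labels not pointing to \<open>v\<close>; the second ones supply the missing
    \<open>sum q C\<^sub>s * sum q C\<^sub>v\<close>.\<close>
  also have "(\<Sum>c\<in>C. (if \<pi> c = v then 0 else q c * sum q C\<^sub>s) + (if \<pi> c = s then q c * sum q C\<^sub>v else 0)) =
      sum q C\<^sub>s * Q"
  proof -
    have split: "Q = sum q C\<^sub>v + sum q {c \<in> C. \<pi> c \<noteq> v}"
      unfolding Q_def C\<^sub>v_def using assms(2)
      by (subst sum.union_disjoint[symmetric]) (auto intro: sum.cong)
    have "(\<Sum>c\<in>C. if \<pi> c = v then 0 else q c * sum q C\<^sub>s) =
        (\<Sum>c\<in>C. if \<pi> c \<noteq> v then q c * sum q C\<^sub>s else 0)"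
      by (intro sum.cong) auto
    also have "\<dots> = sum q {c \<in> C. \<pi> c \<noteq> v} * sum q C\<^sub>s"
      using assms(2) by (simp add: sum_distrib_right flip: sum.inter_filter)
    finally have "(\<Sum>c\<in>C. if \<pi> c = v then 0 else q c * sum q C\<^sub>s) =
        sum q {c \<in> C. \<pi> c \<noteq> v} * sum q C\<^sub>s" .
    moreover have "(\<Sum>c\<in>C. if \<pi> c = s then q c * sum q C\<^sub>v else 0) = sum q C\<^sub>s * sum q C\<^sub>v"
      using assms(2) by (simp add: sum_distrib_right C\<^sub>s_def flip: sum.inter_filter)
    ultimately show ?thesis
      by (simp add: sum.distrib split algebra_simps)
  qed
  finally show ?case
    using insert.hyps by (simp add: Q_def C\<^sub>s_def mult.assoc)
qed

section \<open>First exits, and contraction of a whole set\<close>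

text \<open>Used to contract all of \<open>M\<close> at once: an arrow into \<open>M\<close> is
  continued to the place where its orbit first leaves \<open>M\<close>. The \<open>LEAST\<close> is
  meaningful only if the orbit does leave \<open>M\<close>, which acyclicity on \<open>M\<close>
  ensures.\<close>

definition exit_from :: "'a set \<Rightarrow> ('a \<Rightarrow> 'a) \<Rightarrow> 'a \<Rightarrow> 'a" where
  "exit_from M f v = (f ^^ (LEAST k. (f ^^ k) v \<notin> M)) v"

text \<open>Otherwise the forward orbit of \<open>v\<close> would be a nonempty invariant subset of
  \<open>M\<close>.\<close>

lemma acyclic_on_leaves:
  assumes "acyclic_on M f"
  shows "\<exists>k. (f ^^ k) v \<notin> M"
proof (rule ccontr)
  assume "\<not> ?thesis"
  then have "range (\<lambda>k. (f ^^ k) v) \<subseteq> M" by auto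
  moreover have "f u \<in> range (\<lambda>k. (f ^^ k) v)" if "u \<in> range (\<lambda>k. (f ^^ k) v)" for u
    using that by (auto intro: range_eqI[of _ _ "Suc _"])
  ultimately have "range (\<lambda>k. (f ^^ k) v) = {}"
    by (rule acyclic_onD[OF assms])
  then show False by simp
qed

lemma exit_from_notin: "acyclic_on M f \<Longrightarrow> exit_from M f v \<notin> M"
  unfolding exit_from_def by (rule LeastI_ex[OF acyclic_on_leaves])

lemma exit_from_outside: "v \<notin> M \<Longrightarrow> exit_from M f v = v"
  unfolding exit_from_def by (subst Least_eq_0) auto

lemma exit_from_step:
  assumes "acyclic_on M f" "v \<in> M"
  shows "exit_from M f v = exit_from M f (f v)"
proof -
  obtain k where "(f ^^ k) v \<notin> M"
    using acyclic_on_leaves[OF assms(1)] by blast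
  then have "(LEAST k. (f ^^ k) v \<notin> M) = Suc (LEAST k. (f ^^ Suc k) v \<notin> M)"
    using assms(2) by (intro Least_Suc) auto
  then show ?thesis
    by (simp add: exit_from_def funpow_swap1)
qed

lemma exit_from_closed:
  assumes "v \<in> S" "\<And>u. u \<in> S \<Longrightarrow> f u \<in> S"
  shows "exit_from M f v \<in> S"
proof -
  have "(f ^^ k) v \<in> S" for k
    by (induction k) (use assms in auto)
  then show ?thesis
    by (simp add: exit_from_def)
qed

text \<open>Up to the first exit both maps are applied only at points of \<open>M\<close>, where
  they agree, so the two orbits coincide that far.\<close>

lemma exit_from_cong:
  assumes "acyclic_on M f" "\<And>u. u \<in> M \<Longrightarrow> f u = g u"
  shows "exit_from M f v = exit_from M g v"
proof -
  have *: "(f ^^ k) v = (g ^^ k) v" if "\<forall>j<k. (f ^^ j) v \<in> M" for k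
    using that by (induction k) (auto simp: assms(2))
  have "(LEAST k. (f ^^ k) v \<notin> M) = (LEAST k. (g ^^ k) v \<notin> M)" (is "?k = _")
  proof (rule Least_equality[symmetric])
    have below: "\<forall>j<?k. (f ^^ j) v \<in> M"
      using not_less_Least by blast
    have "(f ^^ ?k) v \<notin> M"
      by (rule LeastI_ex[OF acyclic_on_leaves[OF assms(1)]])
    then show "(g ^^ ?k) v \<notin> M"
      using *[OF below] by simp
    show "?k \<le> j" if "(g ^^ j) v \<notin> M" for j
    proof (rule ccontr)
      assume "\<not> ?k \<le> j"
      then have "(f ^^ j) v = (g ^^ j) v" "(f ^^ j) v \<in> M"
        using below by (auto intro: *)
      then show False using that by simp
    qed
  qed
  moreover have "(f ^^ ?k) v = (g ^^ ?k) v"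
    using not_less_Least by (intro *) blast
  ultimately show ?thesis
    by (simp add: exit_from_def)
qed

text \<open>An invariant set of the contracted map pulls back to the points of
  \<open>M \<union> K\<close> whose exit lies in it, and this set is invariant under
  \<open>f\<close>. Conversely, an \<open>f\<close>-invariant set meets \<open>K\<close> in an
  invariant set of the contracted map, and it cannot lie entirely in \<open>M\<close>.\<close>

lemma acyclic_on_Un:
  assumes "acyclic_on M f" "M \<inter> K = {}"
  shows "acyclic_on (M \<union> K) f \<longleftrightarrow> acyclic_on K (\<lambda>v. exit_from M f (f v))"
proof
  assume ac: "acyclic_on (M \<union> K) f"
  show "acyclic_on K (\<lambda>v. exit_from M f (f v))"
  proof (rule acyclic_onI)
    fix S assume S: "S \<subseteq> K" "S \<noteq> {}" "\<And>v. v \<in> S \<Longrightarrow> exit_from M f (f v) \<in> S"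
    let ?S = "{v \<in> M \<union> K. exit_from M f v \<in> S}"
    have outside: "exit_from M f v = v" if "v \<in> K" for v
      using that assms(2) by (intro exit_from_outside) auto
    have "?S = {}"
    proof (rule acyclic_onD[OF ac])
      show "f v \<in> ?S" if "v \<in> ?S" for v
      proof -
        have *: "exit_from M f (f v) \<in> S"
        proof (cases "v \<in> M")
          case True
          then show ?thesis using that exit_from_step[OF assms(1)] by simp
        next
          case False
          then show ?thesis using that outside S(3) by auto
        qed
        moreover have "f v \<in> M \<union> K"
          using * S(1) exit_from_outside[of "f v" M f] by (cases "f v \<in> M") auto
        ultimately show ?thesis by simp
      qed
    qed auto
    moreover have "S \<subseteq> ?S"
      using S(1) outside by auto
    ultimately show False
      using S(2) by auto
  qed
next
  assume ac: "acyclic_on K (\<lambda>v. exit_from M f (f v))"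
  show "acyclic_on (M \<union> K) f"
  proof (rule acyclic_onI)
    fix S assume S: "S \<subseteq> M \<union> K" "S \<noteq> {}" "\<And>v. v \<in> S \<Longrightarrow> f v \<in> S"
    have "S \<inter> K = {}"
    proof (rule acyclic_onD[OF ac])
      show "exit_from M f (f v) \<in> S \<inter> K" if "v \<in> S \<inter> K" for v
      proof -
        have "exit_from M f (f v) \<in> S"
          by (rule exit_from_closed) (use that S(3) in auto)
        then show ?thesis
          using exit_from_notin[OF assms(1)] S(1) by blast
      qed
    qed auto
    then have "S = {}"
      using S by (intro acyclic_onD[OF assms(1)]) auto
    then show False using S(2) by simp
  qed
qed


section \<open>Trading cycles through jumps for a marked jump\<close>

text \<open>The key identity: a configuration in which only the jumps out of \<open>J\<close> may close cycles is traded
  for a parent function rooted at \<open>r \<in> J\<close> together with a free choice of a jump target for \<open>r\<close>.\<close>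

lemma sum_jumps:
  fixes z :: "'a \<Rightarrow> 'r::comm_ring_1"
  assumes "finite V" "V \<noteq> {}" "J \<subseteq> V" "B \<subseteq> V"
    and f: "\<And>v. v \<in> V - J \<Longrightarrow> f v \<in> V"
  defines "\<And>h. g h \<equiv> \<lambda>v. if v \<in> J then h v else f v"
  shows "(\<Sum>r\<in>J. \<Sum>h\<in>J \<rightarrow>\<^sub>E B. if acyclic_on (V - {r}) (g h) then \<Prod>v\<in>J. z (h v) else 0) =
    (\<Sum>h\<in>J \<rightarrow>\<^sub>E B. if acyclic_on (V - J) (g h) then \<Prod>v\<in>J. z (h v) else 0)"
proof (cases "acyclic_on (V - J) f")
  \<comment> \<open>A cycle of \<open>f\<close> off \<open>J\<close> survives in every
    \<open>g h\<close> and avoids every root in \<open>J\<close>, so both sides vanish.\<close>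
  case False
  have "acyclic_on (V - J) (g h) \<longleftrightarrow> acyclic_on (V - J) f" for h
    by (rule acyclic_on_cong) (simp add: g_def)
  with False have *: "\<not> acyclic_on (V - J) (g h)" for h
    by simp
  then have "\<not> acyclic_on (V - {r}) (g h)" if "r \<in> J" for r h
    using that by (metis Diff_mono acyclic_on_subset empty_subsetI insert_subset subset_refl)
  with * show ?thesis by simp
next
  case True
  note ac = this
  have ac_g: "acyclic_on (V - J) (g h)" for h
    by (rule acyclic_on_cong[THEN iffD1, OF _ ac]) (simp add: g_def)
  have fin: "finite J" "finite B"
    using assms(1,3,4) finite_subset by blast+
  \<comment> \<open>Once \<open>V - J\<close> is contracted, a jump to \<open>b\<close> amounts to
    an arrow to \<open>e b\<close> in \<open>J\<close>.\<close>
  define e where "e = exit_from (V - J) f"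
  have e: "e v \<in> J" if "v \<in> V" for v
  proof -
    \<comment> \<open>Nothing is known about \<open>f\<close> on \<open>J\<close>. Making it the
      identity there keeps orbits inside \<open>V\<close> and does not affect first exits from
      \<open>V - J\<close>.\<close>
    have "exit_from (V - J) (\<lambda>u. if u \<in> J then u else f u) v \<in> V"
      by (rule exit_from_closed) (use that f in auto)
    also have "exit_from (V - J) (\<lambda>u. if u \<in> J then u else f u) v = e v"
      unfolding e_def by (rule exit_from_cong[symmetric, OF ac]) auto
    finally show ?thesis
      using exit_from_notin[OF ac, of v] by (auto simp: e_def)
  qed
  have "J \<noteq> {}"
    using e assms(2) by blast
  \<comment> \<open>The target of \<open>r\<close> is unconstrained and contributes a factor
    \<open>sum z B\<close>. This is the extra factor required by
    \<open>sum_acyclic_labellings\<close>, which is applied to \<open>K = J - {r}\<close> with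
    labels \<open>B\<close>, endpoint map \<open>e\<close> and root \<open>r\<close>.\<close>
  have root: "(\<Sum>h\<in>J \<rightarrow>\<^sub>E B. if acyclic_on (V - {r}) (g h) then \<Prod>v\<in>J. z (h v) else 0) =
      sum z {b \<in> B. e b = r} * sum z B ^ (card J - 1)" if r: "r \<in> J" for r
  proof -
    define K where "K = J - {r}"
    have J: "J = insert r K" "r \<notin> K" and "finite K"
      using r fin by (auto simp: K_def)
    have iff: "acyclic_on (V - {r}) (g h) \<longleftrightarrow> acyclic_on K (\<lambda>v. e (h v))" for h
    proof -
      have "V - {r} = (V - J) \<union> K"
        using assms(3) J by auto
      then have "acyclic_on (V - {r}) (g h) \<longleftrightarrow> acyclic_on K (\<lambda>v. exit_from (V - J) (g h) (g h v))"
        using acyclic_on_Un[OF ac_g[of h], of K] J by auto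
      also have "\<dots> \<longleftrightarrow> acyclic_on K (\<lambda>v. e (h v))"
      proof (rule acyclic_on_cong)
        fix v assume "v \<in> K"
        have "exit_from (V - J) (g h) (g h v) = e (g h v)"
          unfolding e_def by (rule exit_from_cong[OF ac_g]) (simp add: g_def)
        then show "exit_from (V - J) (g h) (g h v) = e (h v)"
          using \<open>v \<in> K\<close> J by (simp add: g_def)
      qed
      finally show ?thesis .
    qed
    have "(\<Sum>h\<in>J \<rightarrow>\<^sub>E B. if acyclic_on (V - {r}) (g h) then \<Prod>v\<in>J. z (h v) else 0) =
        (\<Sum>c\<in>B. \<Sum>h\<in>K \<rightarrow>\<^sub>E B. if acyclic_on K (\<lambda>v. e ((h(r := c)) v))
          then \<Prod>v\<in>insert r K. z ((h(r := c)) v) else 0)"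
      unfolding iff J(1) by (rule sum_PiE_insert[OF J(2)])
    also have "\<dots> = (\<Sum>c\<in>B. z c * (\<Sum>h\<in>K \<rightarrow>\<^sub>E B. if acyclic_on K (\<lambda>v. e (h v))
          then \<Prod>v\<in>K. z (h v) else 0))"
    proof (rule sum.cong[OF refl])
      fix c
      have "acyclic_on K (\<lambda>v. e ((h(r := c)) v)) \<longleftrightarrow> acyclic_on K (\<lambda>v. e (h v))" for h
        by (rule acyclic_on_cong) (use J(2) in auto)
      moreover have "(\<Prod>v\<in>insert r K. z ((h(r := c)) v)) = z c * (\<Prod>v\<in>K. z (h v))" for h
      proof -
        have "(\<Prod>v\<in>K. z ((h(r := c)) v)) = (\<Prod>v\<in>K. z (h v))"
          by (rule prod.cong) (use J(2) in auto)
        then show ?thesis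
          using J(2) \<open>finite K\<close> by simp
      qed
      ultimately show "(\<Sum>h\<in>K \<rightarrow>\<^sub>E B. if acyclic_on K (\<lambda>v. e ((h(r := c)) v))
          then \<Prod>v\<in>insert r K. z ((h(r := c)) v) else 0) =
        z c * (\<Sum>h\<in>K \<rightarrow>\<^sub>E B. if acyclic_on K (\<lambda>v. e (h v)) then \<Prod>v\<in>K. z (h v) else 0)"
        by (auto simp: sum_distrib_left intro!: sum.cong)
    qed
    also have "\<dots> = (\<Sum>h\<in>K \<rightarrow>\<^sub>E B. if acyclic_on K (\<lambda>v. e (h v)) then \<Prod>v\<in>K. z (h v) else 0) * sum z B"
      by (simp add: sum_distrib_right mult.commute)
    also have "\<dots> = sum z {b \<in> B. e b = r} * sum z B ^ card K"
      by (rule sum_acyclic_labellings) (use \<open>finite K\<close> fin J e assms(4) in auto)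
    finally show ?thesis
      using J \<open>finite K\<close> by simp
  qed
  \<comment> \<open>The fibres of \<open>e\<close> partition \<open>B\<close>, so summing over the
    roots restores one factor \<open>sum z B\<close>. The result is the weight of all free choices
    of jump targets.\<close>
  have "(\<Sum>r\<in>J. sum z {b \<in> B. e b = r}) = sum z B"
    using sum.group[of B J e z] fin e assms(4) by auto
  then have "(\<Sum>r\<in>J. \<Sum>h\<in>J \<rightarrow>\<^sub>E B. if acyclic_on (V - {r}) (g h) then \<Prod>v\<in>J. z (h v) else 0) =
      sum z B * sum z B ^ (card J - 1)"
    by (simp add: root flip: sum_distrib_right)
  also have "\<dots> = sum z B ^ card J"
    using fin(1) \<open>J \<noteq> {}\<close> by (simp add: card_gt_0_iff flip: power_Suc)
  also have "\<dots> = (\<Prod>v\<in>J. sum z B)"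
    by simp
  also have "\<dots> = (\<Sum>h\<in>J \<rightarrow>\<^sub>E B. \<Prod>v\<in>J. z (h v))"
    by (rule prod_sum_PiE) (use fin in auto)
  finally show ?thesis
    by (simp add: ac_g)
qed

text \<open>The factor \<open>sum z B\<close> on the left chooses a target in \<open>B\<close> for
  the root, which turns a map on \<open>V - {r}\<close> into one on \<open>V\<close> with a marked
  jump at \<open>r\<close>. Both sides are then split by the set \<open>J\<close> of all jumping
  vertices; for fixed \<open>J\<close> and fixed values off \<open>J\<close> the identity is
  \<open>sum_jumps\<close>.\<close>

lemma sum_unicyclic:
  fixes z :: "'a \<Rightarrow> 'r::comm_ring_1"
  assumes "finite V" "V \<noteq> {}" "A \<subseteq> V"
    and nb: "\<And>v. v \<in> V \<Longrightarrow> nb v \<subseteq> V" and B: "\<And>v. v \<in> A \<Longrightarrow> B \<subseteq> nb v" "B \<subseteq> V"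
  shows "(\<Sum>r\<in>A. sum z B *
      (\<Sum>g\<in>PiE (V - {r}) nb. if acyclic_on (V - {r}) g then \<Prod>v\<in>V - {r}. z (g v) else 0)) =
    (\<Sum>g\<in>PiE V nb. if acyclic_on (V - {v \<in> A. g v \<in> B}) g then \<Prod>v\<in>V. z (g v) else 0)"
    (is "?L = ?R")
proof -
  have finA: "finite A"
    using assms(1,3) finite_subset by blast
  have fin_nb: "finite (nb v)" if "v \<in> V" for v
    using nb[OF that] assms(1) finite_subset by blast
  have fin: "finite (PiE V nb)"
    using assms(1) fin_nb by (intro finite_PiE) auto
  have rooted: "sum z B * (\<Sum>g\<in>PiE (V - {r}) nb. if acyclic_on (V - {r}) g then \<Prod>v\<in>V - {r}. z (g v) else 0) =
      (\<Sum>g\<in>PiE V nb. if g r \<in> B \<and> acyclic_on (V - {r}) g then \<Prod>v\<in>V. z (g v) else 0)"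
    if r: "r \<in> A" for r
  proof -
    let ?U = "V - {r}"
    have V: "V = insert r ?U" "finite ?U"
      using r assms(1,3) by auto
    have "(\<Sum>g\<in>PiE V nb. if g r \<in> B \<and> acyclic_on ?U g then \<Prod>v\<in>V. z (g v) else 0) =
      (\<Sum>c\<in>nb r. \<Sum>f\<in>PiE ?U nb. if (f(r := c)) r \<in> B \<and> acyclic_on ?U (f(r := c))
        then \<Prod>v\<in>V. z ((f(r := c)) v) else 0)"
      by (subst V(1), rule sum_PiE_insert) simp
    also have "\<dots> = (\<Sum>c\<in>nb r. if c \<in> B then z c *
        (\<Sum>f\<in>PiE ?U nb. if acyclic_on ?U f then \<Prod>v\<in>?U. z (f v) else 0) else 0)"
    proof (rule sum.cong[OF refl])
      fix c
      have "acyclic_on ?U (f(r := c)) \<longleftrightarrow> acyclic_on ?U f" for f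
        by (rule acyclic_on_cong) auto
      moreover have "(\<Prod>v\<in>V. z ((f(r := c)) v)) = z c * (\<Prod>v\<in>?U. z (f v))" for f
      proof -
        have "(\<Prod>v\<in>?U. z ((f(r := c)) v)) = (\<Prod>v\<in>?U. z (f v))"
          by (rule prod.cong) auto
        then show ?thesis
          using r assms(1,3) by (subst prod.remove[of V r]) auto
      qed
      ultimately show "(\<Sum>f\<in>PiE ?U nb. if (f(r := c)) r \<in> B \<and> acyclic_on ?U (f(r := c))
          then \<Prod>v\<in>V. z ((f(r := c)) v) else 0) =
        (if c \<in> B then z c * (\<Sum>f\<in>PiE ?U nb. if acyclic_on ?U f then \<Prod>v\<in>?U. z (f v) else 0) else 0)"
        by (auto simp: sum_distrib_left intro!: sum.cong)
    qed
    also have "\<dots> = (\<Sum>c\<in>B. z c * (\<Sum>f\<in>PiE ?U nb. if acyclic_on ?U f then \<Prod>v\<in>?U. z (f v) else 0))"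
      using B(1)[OF r] r assms(3) fin_nb by (subst sum.inter_restrict[symmetric]) (auto simp: Int_absorb1)
    finally show ?thesis
      by (simp add: sum_distrib_right)
  qed
  define jumps where "jumps g = {v \<in> A. g v \<in> B}" for g :: "'a \<Rightarrow> 'a"
  define \<Omega> where "\<Omega> J = {g \<in> PiE V nb. jumps g = J}" for J
  have by_jumps: "(\<Sum>g\<in>PiE V nb. F g) = (\<Sum>J\<in>Pow A. \<Sum>g\<in>\<Omega> J. F g)" for F :: "('a \<Rightarrow> 'a) \<Rightarrow> 'r"
    unfolding \<Omega>_def by (rule sum.group[symmetric]) (use fin finA in \<open>auto simp: jumps_def\<close>)
  have "?L = (\<Sum>r\<in>A. \<Sum>g\<in>PiE V nb. if r \<in> jumps g \<and> acyclic_on (V - {r}) g then \<Prod>v\<in>V. z (g v) else 0)"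
    by (rule sum.cong[OF refl]) (simp add: rooted jumps_def)
  also have "\<dots> = (\<Sum>J\<in>Pow A. \<Sum>r\<in>A. \<Sum>g\<in>\<Omega> J. if r \<in> jumps g \<and> acyclic_on (V - {r}) g then \<Prod>v\<in>V. z (g v) else 0)"
    unfolding by_jumps by (rule sum.swap)
  also have "\<dots> = (\<Sum>J\<in>Pow A. \<Sum>g\<in>\<Omega> J. if acyclic_on (V - J) g then \<Prod>v\<in>V. z (g v) else 0)"
  proof (rule sum.cong[OF refl])
    fix J assume "J \<in> Pow A"
    then have J: "J \<subseteq> A" "J \<subseteq> V" "finite J" using assms(3) finA finite_subset by auto
    \<comment> \<open>With \<open>T\<close> the set \<open>\<Omega> J\<close> becomes a product:
      vertices of \<open>J\<close> must jump, those of \<open>A - J\<close> must not, the others are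
      free.\<close>
    define T where "T v = (if v \<in> J then B else if v \<in> A then nb v - B else nb v)" for v
    have V: "V = J \<union> (V - J)" using J by auto
    have \<Omega>: "\<Omega> J = PiE (J \<union> (V - J)) T"
    proof -
      have "g \<in> \<Omega> J \<longleftrightarrow> g \<in> PiE V T" for g
        using J B(1) assms(3) by (auto simp: \<Omega>_def jumps_def PiE_iff T_def set_eq_iff) blast+
      then show ?thesis using V by auto
    qed
    have PiE_J: "PiE J T = J \<rightarrow>\<^sub>E B"
      by (rule PiE_cong) (simp add: T_def)
    let ?g = "\<lambda>h f v. if v \<in> J then h v else f v"
    have prod_g: "(\<Prod>v\<in>V. z (?g h f v)) = (\<Prod>v\<in>J. z (h v)) * (\<Prod>v\<in>V - J. z (f v))" for h f
    proof -
      have "(\<Prod>v\<in>V. z (?g h f v)) = (\<Prod>v\<in>J. z (?g h f v)) * (\<Prod>v\<in>V - J. z (?g h f v))"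
        by (subst mult.commute) (rule prod.subset_diff[OF J(2) assms(1)])
      moreover have "(\<Prod>v\<in>V - J. z (?g h f v)) = (\<Prod>v\<in>V - J. z (f v))"
        by (rule prod.cong) auto
      ultimately show ?thesis by simp
    qed
    \<comment> \<open>The weight off \<open>J\<close> factors out and leaves the inner sum over jump
      targets treated by \<open>sum_jumps\<close>.\<close>
    have expand: "(\<Sum>g\<in>\<Omega> J. if acyclic_on X g then \<Prod>v\<in>V. z (g v) else 0) =
        (\<Sum>f\<in>PiE (V - J) T. (\<Sum>h\<in>J \<rightarrow>\<^sub>E B. if acyclic_on X (?g h f) then \<Prod>v\<in>J. z (h v) else 0) *
          (\<Prod>v\<in>V - J. z (f v)))" for X
    proof -
      have "(\<Sum>g\<in>\<Omega> J. if acyclic_on X g then \<Prod>v\<in>V. z (g v) else 0) =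
        (\<Sum>h\<in>J \<rightarrow>\<^sub>E B. \<Sum>f\<in>PiE (V - J) T. if acyclic_on X (?g h f) then \<Prod>v\<in>V. z (?g h f v) else 0)"
        unfolding \<Omega> PiE_J[symmetric] by (rule sum_PiE_Un) auto
      also have "\<dots> = (\<Sum>h\<in>J \<rightarrow>\<^sub>E B. \<Sum>f\<in>PiE (V - J) T.
          (if acyclic_on X (?g h f) then \<Prod>v\<in>J. z (h v) else 0) * (\<Prod>v\<in>V - J. z (f v)))"
        unfolding prod_g by (intro sum.cong refl) simp
      also have "\<dots> = (\<Sum>f\<in>PiE (V - J) T. \<Sum>h\<in>J \<rightarrow>\<^sub>E B.
          (if acyclic_on X (?g h f) then \<Prod>v\<in>J. z (h v) else 0) * (\<Prod>v\<in>V - J. z (f v)))"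
        by (rule sum.swap)
      finally show ?thesis
        by (simp add: sum_distrib_right)
    qed
    have "(\<Sum>r\<in>A. \<Sum>g\<in>\<Omega> J. if r \<in> jumps g \<and> acyclic_on (V - {r}) g then \<Prod>v\<in>V. z (g v) else 0) =
        (\<Sum>r\<in>A. if r \<in> J then \<Sum>g\<in>\<Omega> J. if acyclic_on (V - {r}) g then \<Prod>v\<in>V. z (g v) else 0 else 0)"
      by (rule sum.cong[OF refl]) (auto simp: \<Omega>_def intro!: sum.cong sum.neutral)
    also have "\<dots> = (\<Sum>r\<in>J. \<Sum>g\<in>\<Omega> J. if acyclic_on (V - {r}) g then \<Prod>v\<in>V. z (g v) else 0)"
      using J finA by (subst sum.inter_restrict[symmetric]) (auto simp: Int_absorb1)
    also have "\<dots> = (\<Sum>f\<in>PiE (V - J) T. (\<Sum>r\<in>J. \<Sum>h\<in>J \<rightarrow>\<^sub>E B.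
        if acyclic_on (V - {r}) (?g h f) then \<Prod>v\<in>J. z (h v) else 0) * (\<Prod>v\<in>V - J. z (f v)))"
      unfolding expand sum_distrib_right by (rule sum.swap)
    also have "\<dots> = (\<Sum>f\<in>PiE (V - J) T. (\<Sum>h\<in>J \<rightarrow>\<^sub>E B.
        if acyclic_on (V - J) (?g h f) then \<Prod>v\<in>J. z (h v) else 0) * (\<Prod>v\<in>V - J. z (f v)))"
    proof (rule sum.cong[OF refl])
      fix f assume f: "f \<in> PiE (V - J) T"
      have "f v \<in> V" if "v \<in> V - J" for v
        using PiE_mem[OF f that] that nb[of v] by (auto simp: T_def split: if_splits)
      then show "(\<Sum>r\<in>J. \<Sum>h\<in>J \<rightarrow>\<^sub>E B. if acyclic_on (V - {r}) (?g h f) then \<Prod>v\<in>J. z (h v) else 0) *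
            (\<Prod>v\<in>V - J. z (f v)) =
          (\<Sum>h\<in>J \<rightarrow>\<^sub>E B. if acyclic_on (V - J) (?g h f) then \<Prod>v\<in>J. z (h v) else 0) *
            (\<Prod>v\<in>V - J. z (f v))"
        using sum_jumps[OF assms(1,2) J(2) B(2), of f z] by simp
    qed
    also have "\<dots> = (\<Sum>g\<in>\<Omega> J. if acyclic_on (V - J) g then \<Prod>v\<in>V. z (g v) else 0)"
      by (rule expand[symmetric])
    finally show "(\<Sum>r\<in>A. \<Sum>g\<in>\<Omega> J. if r \<in> jumps g \<and> acyclic_on (V - {r}) g then \<Prod>v\<in>V. z (g v) else 0) =
      (\<Sum>g\<in>\<Omega> J. if acyclic_on (V - J) g then \<Prod>v\<in>V. z (g v) else 0)" .
  qed
  also have "\<dots> = (\<Sum>J\<in>Pow A. \<Sum>g\<in>\<Omega> J. if acyclic_on (V - jumps g) g then \<Prod>v\<in>V. z (g v) else 0)"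
    by (intro sum.cong refl) (auto simp: \<Omega>_def)
  also have "\<dots> = ?R"
    unfolding by_jumps[symmetric] jumps_def ..
  finally show ?thesis .
qed


section \<open>Spanning trees as parent functions\<close>

definition parent_graph :: "'a set \<Rightarrow> 'a \<Rightarrow> ('a \<Rightarrow> 'a) \<Rightarrow> 'a ugraph" where
  "parent_graph V r f = \<lparr>verts = V, edges = (\<lambda>v. {v, f v}) ` (V - {r})\<rparr>"

text \<open>Remove a vertex whose image leaves \<open>N\<close>, rank the rest by induction, shift
  these ranks by one and give the removed vertex rank 0.\<close>

lemma acyclic_on_rank:
  assumes "finite N" "acyclic_on N f"
  obtains d :: "'a \<Rightarrow> nat" where "\<And>v. v \<in> N \<Longrightarrow> f v \<in> N \<Longrightarrow> d (f v) < d v"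
proof -
  have "\<exists>d::'a \<Rightarrow> nat. \<forall>v\<in>N. f v \<in> N \<longrightarrow> d (f v) < d v"
    using assms
  proof (induction N rule: finite_psubset_induct)
    case (psubset N)
    show ?case
    proof (cases "N = {}")
      case False
      then obtain v where v: "v \<in> N" "f v \<notin> N"
        using psubset.prems by (auto simp: acyclic_on_def)
      have "acyclic_on (N - {v}) f"
        using psubset.prems by (rule acyclic_on_subset) auto
      then obtain d :: "'a \<Rightarrow> nat" where d: "\<forall>u\<in>N - {v}. f u \<in> N - {v} \<longrightarrow> d (f u) < d u"
        using psubset.IH[of "N - {v}"] v by auto
      have "\<forall>u\<in>N. f u \<in> N \<longrightarrow> (if f u = v then 0 else Suc (d (f u))) < (if u = v then 0 else Suc (d u))"
        using d v by auto
      then show ?thesis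
        by (intro exI[of _ "\<lambda>u. if u = v then 0 else Suc (d u)"])
    qed simp
  qed
  then show thesis
    using that by blast
qed

lemma acyclic_on_no_2_cycle:
  assumes "acyclic_on N f" "u \<in> N" "v \<in> N" "f u = v"
  shows "f v \<noteq> u"
proof
  assume "f v = u"
  have "{u, v} = {}"
  proof (rule acyclic_onD[OF assms(1)])
    show "f w \<in> {u, v}" if "w \<in> {u, v}" for w
      using that assms(4) \<open>f v = u\<close> by (cases "w = u") simp_all
  qed (use assms(2,3) in simp)
  then show False by simp
qed

section \<open>Simple paths and the cycles they close\<close>

text \<open>Extend the path edge by edge; if the new vertex already lies on it, cut the path off
  there.\<close>

lemma simple_path_exists:
  assumes "(u, v) \<in> {(a, b). {a, b} \<in> E}\<^sup>*"
  shows "\<exists>p. p \<noteq> [] \<and> hd p = u \<and> last p = v \<and> distinct p \<and> successively (\<lambda>a b. {a, b} \<in> E) p"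
  using assms
proof (induction rule: rtrancl_induct)
  case base
  show ?case by (rule exI[of _ "[u]"]) simp
next
  case (step y z)
  then obtain p where p: "p \<noteq> []" "hd p = u" "last p = y" "distinct p" "successively (\<lambda>a b. {a, b} \<in> E) p"
    by blast
  show ?case
  proof (cases "z \<in> set p")
    case True
    then obtain xs ys where "p = xs @ z # ys"
      by (meson split_list)
    then show ?thesis
      using p by (intro exI[of _ "xs @ [z]"]) (auto simp: successively_append_iff hd_append)
  next
    case False
    then show ?thesis
      using p step.hyps by (intro exI[of _ "p @ [z]"]) (auto simp: successively_append_iff)
  qed
qed

text \<open>Two vertices suffice for every vertex of the path, including the last, to be an end of
  one of its edges.\<close>

lemma successively_in_verts:
  assumes "successively (\<lambda>a b. {a, b} \<in> E) p" "\<And>e. e \<in> E \<Longrightarrow> e \<subseteq> V" "2 \<le> length p"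
  shows "set p \<subseteq> V"
proof
  fix x assume "x \<in> set p"
  then obtain i where i: "i < length p" "x = p ! i"
    by (auto simp: in_set_conv_nth)
  have step: "{p ! j, p ! Suc j} \<subseteq> V" if "Suc j < length p" for j
    using assms(2)[of "{p ! j, p ! Suc j}"] assms(1) that by (simp add: successively_conv_nth)
  show "x \<in> V"
  proof (cases "Suc i < length p")
    case True
    then show ?thesis using step[of i] i by simp
  next
    case False
    then show ?thesis using step[of "i - 1"] i assms(3) by (cases i) auto
  qed
qed

text \<open>A simple path in \<open>E\<close> from \<open>u\<close> to \<open>v\<close> has at least
  three vertices, since \<open>u \<noteq> v\<close> and \<open>{u, v}\<close> is not in
  \<open>E\<close>. The edge \<open>{u, v}\<close> then closes it to a cycle.\<close>

lemma closing_edge_gives_cycle: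
  assumes "(u, v) \<in> {(a, b). {a, b} \<in> E}\<^sup>*" "{u, v} \<in> edges T" "{u, v} \<notin> E" "u \<noteq> v"
    and "E \<subseteq> edges T" "\<And>e. e \<in> edges T \<Longrightarrow> e \<subseteq> verts T"
  shows "\<exists>c. graph_cycle T c"
proof -
  obtain p where p: "p \<noteq> []" "hd p = u" "last p = v" "distinct p" "successively (\<lambda>a b. {a, b} \<in> E) p"
    using simple_path_exists[OF assms(1)] by blast
  have len: "3 \<le> length p"
  proof (rule ccontr)
    assume "\<not> 3 \<le> length p"
    moreover have "0 < length p"
      using p(1) by simp
    ultimately have "length p = 1 \<or> length p = 2"
      by linarith
    then show False
    proof
      assume "length p = 1"
      then show False using p(2,3) assms(4) by (auto simp: length_Suc_conv)
    next
      assume "length p = 2"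
      then have "p = [u, v]"
        using p(2,3) by (auto simp: numeral_2_eq_2 length_Suc_conv)
      then show False using p(5) assms(3) by simp
    qed
  qed
  have "{p ! i, p ! (Suc i mod length p)} \<in> edges T" if "i < length p" for i
  proof (cases "Suc i < length p")
    case True
    then show ?thesis
      using p(5) assms(5) by (auto simp: successively_conv_nth)
  next
    case False
    then have "Suc i = length p" using that by simp
    moreover from this have "p ! i = v"
      using p(1,3) by (simp add: last_conv_nth flip: \<open>Suc i = length p\<close>)
    moreover have "p ! 0 = u"
      using p(1,2) by (simp add: hd_conv_nth)
    ultimately show ?thesis
      using assms(2) by (simp add: insert_commute)
  qed
  moreover have "set p \<subseteq> verts T"
    using p(5) assms(5,6) len by (intro successively_in_verts[of E]) auto
  ultimately show ?thesis
    using p(4) len by (auto simp: graph_cycle_def)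
qed

section \<open>The tree of an acyclic parent function and its degrees\<close>

context
  fixes V :: "'a set" and r :: 'a and f :: "'a \<Rightarrow> 'a"
  assumes fin: "finite V" and root: "r \<in> V"
    and range: "\<And>v. v \<in> V - {r} \<Longrightarrow> f v \<in> V"
    and acyclic: "acyclic_on (V - {r}) f"
begin

text \<open>The vertices not connected to \<open>r\<close> form a subset of \<open>V - {r}\<close>
  invariant under \<open>f\<close>.\<close>

lemma parent_graph_reaches_root:
  assumes "v \<in> V"
  shows "(v, r) \<in> {(a, b). {a, b} \<in> edges (parent_graph V r f)}\<^sup>*" (is "_ \<in> ?R\<^sup>*")
proof -
  have step: "(v, f v) \<in> ?R" if "v \<in> V - {r}" for v
    using that by (auto simp: parent_graph_def)
  have "{v \<in> V. (v, r) \<notin> ?R\<^sup>*} = {}"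
  proof (rule acyclic_onD[OF acyclic])
    show "f v \<in> {v \<in> V. (v, r) \<notin> ?R\<^sup>*}" if v: "v \<in> {v \<in> V. (v, r) \<notin> ?R\<^sup>*}" for v
    proof -
      have "v \<in> V - {r}" using v by auto
      then show ?thesis
        using step[of v] v range[of v] by (auto intro: converse_rtrancl_into_rtrancl)
    qed
  qed auto
  then show ?thesis using assms by blast
qed

lemma connected_parent_graph: "connected_graph (parent_graph V r f)"
proof -
  let ?R = "{(a, b). {a, b} \<in> edges (parent_graph V r f)}"
  have "sym ?R" by (auto simp: sym_def insert_commute)
  then have "sym (?R\<^sup>*)" by (rule sym_rtrancl)
  then have "(r, v) \<in> ?R\<^sup>*" if "v \<in> V" for v
    using parent_graph_reaches_root[OF that] by (rule symD)
  then show ?thesis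
    using root parent_graph_reaches_root unfolding connected_graph_def
    by (auto simp: parent_graph_def intro: rtrancl_trans)
qed

text \<open>On a cycle both neighbours of a vertex of maximal rank would be its parent.\<close>

lemma parent_graph_no_cycle: "\<not> graph_cycle (parent_graph V r f) c"
proof
  assume cyc: "graph_cycle (parent_graph V r f) c"
  define k where "k = length c"
  have k: "3 \<le> k" and dist: "distinct c" and sub: "set c \<subseteq> V"
    and edge: "\<And>i. i < k \<Longrightarrow> {c ! i, c ! (Suc i mod k)} \<in> (\<lambda>v. {v, f v}) ` (V - {r})"
    using cyc by (auto simp: graph_cycle_def parent_graph_def k_def)
  obtain d :: "'a \<Rightarrow> nat" where d: "\<And>v. v \<in> V - {r} \<Longrightarrow> f v \<in> V - {r} \<Longrightarrow> d (f v) < d v"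
    using acyclic_on_rank[OF _ acyclic] fin by blast
  \<comment> \<open>The rank \<open>d\<close> decreases only while the parent stays in
    \<open>V - {r}\<close>; shifting it and giving the root 0 makes it decrease along edges into the
    root too.\<close>
  define d' where "d' v = (if v = r then 0 else Suc (d v))" for v
  have d': "d' (f v) < d' v" if "v \<in> V - {r}" for v
    using that d[of v] range[of v] by (auto simp: d'_def)
  obtain i where i: "i < k" and max: "\<And>j. j < k \<Longrightarrow> d' (c ! j) \<le> d' (c ! i)"
  proof -
    let ?D = "(\<lambda>j. d' (c ! j)) ` {..<k}"
    have "Max ?D \<in> ?D"
      using k by (intro Max_in) (auto simp: lessThan_empty_iff)
    then obtain i where "i < k" "d' (c ! i) = Max ?D"
      by auto
    then show thesis
      using that by (metis (no_types, lifting) Max_ge finite_imageI finite_lessThan imageI lessThan_iff)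
  qed
  have parent: "y = f (c ! i)" if "{c ! i, y} \<in> (\<lambda>v. {v, f v}) ` (V - {r})" "d' y \<le> d' (c ! i)" for y
    using that(1)
  proof (rule imageE)
    fix v assume v: "{c ! i, y} = {v, f v}" "v \<in> V - {r}"
    then show ?thesis
      using d'[OF v(2)] that(2) by (auto simp: doubleton_eq_iff)
  qed
  \<comment> \<open>The cyclic successor and predecessor of \<open>i\<close>, distinct because
    \<open>k\<close> is at least 3. Adding \<open>k\<close> before subtracting avoids truncation at
    \<open>i = 0\<close>.\<close>
  let ?s = "Suc i mod k" and ?p = "(i + k - 1) mod k"
  have sp: "?s < k" "?p < k" "Suc ?p mod k = i" "?s \<noteq> ?p"
  proof -
    show "?s < k" "?p < k" using k by auto
    show "Suc ?p mod k = i" using i k by (simp add: mod_Suc_eq)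
    show "?s \<noteq> ?p"
    proof (cases "i = 0")
      case True
      then show ?thesis using k by simp
    next
      case False
      then have "?p = i - 1"
        using i k by (simp add: mod_if)
      moreover have "?s = (if Suc i = k then 0 else Suc i)"
        using i by simp
      ultimately show ?thesis using k i False by auto
    qed
  qed
  have "c ! ?s = f (c ! i)"
    using edge[OF i] max[OF sp(1)] by (rule parent)
  moreover have "c ! ?p = f (c ! i)"
    using edge[OF sp(2)] max[OF sp(2)] sp(3) by (intro parent) (simp_all add: insert_commute)
  ultimately have "?s = ?p"
    using dist sp(1,2) by (metis k_def nth_eq_iff_index_eq)
  then show False using sp(4) by simp
qed

lemma tree_parent_graph: "tree_graph (parent_graph V r f)"
  by (simp add: tree_graph_def connected_parent_graph parent_graph_no_cycle)

lemma inj_on_parent_edge: "inj_on (\<lambda>v. {v, f v}) (V - {r})"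
proof (rule inj_onI)
  fix u v assume uv: "u \<in> V - {r}" "v \<in> V - {r}" "{u, f u} = {v, f v}"
  then have "u = v \<or> f u = v \<and> f v = u"
    by (auto simp: doubleton_eq_iff)
  then show "u = v"
    using acyclic_on_no_2_cycle[OF acyclic uv(1,2)] by blast
qed

text \<open>Edges are indexed injectively by their child end. Those at \<open>v\<close> come from
  the children of \<open>v\<close> and, unless \<open>v\<close> is the root, from \<open>v\<close>
  itself, which is not its own child.\<close>

lemma vdegree_parent_graph:
  assumes "v \<in> V"
  shows "vdegree (parent_graph V r f) v = card {u \<in> V - {r}. f u = v} + (if v = r then 0 else 1)"
proof -
  let ?C = "{u \<in> V - {r}. f u = v}"
  have "{e \<in> edges (parent_graph V r f). v \<in> e} = (\<lambda>v. {v, f v}) ` (?C \<union> ({v} - {r}))"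
    using assms by (auto simp: parent_graph_def)
  then have "vdegree (parent_graph V r f) v = card (?C \<union> ({v} - {r}))"
    unfolding vdegree_def using assms
    by (simp add: card_image inj_on_subset[OF inj_on_parent_edge] subset_iff)
  also have "\<dots> = card ?C + card ({v} - {r})"
    using acyclic_onD[OF acyclic, of "{v}"] fin by (intro card_Un_disjoint) auto
  finally show ?thesis by auto
qed

text \<open>Off the root, the degree minus one is the number of children. At the root the degree
  itself is that number, so the factor \<open>z r\<close> makes up for the subtracted 1; there is no
  truncation, since \<open>V \<noteq> {r}\<close> gives the root a child. Grouping the vertices by
  their parent yields the right-hand side.\<close>

lemma prod_degrees:
  fixes z :: "'a \<Rightarrow> 'r::comm_semiring_1"
  assumes "V \<noteq> {r}"
  shows "z r * (\<Prod>v\<in>V. z v ^ (vdegree (parent_graph V r f) v - 1)) = (\<Prod>v\<in>V - {r}. z (f v))"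
proof -
  let ?C = "\<lambda>v. {u \<in> V - {r}. f u = v}"
  have "V - {r} \<noteq> {}"
    using assms root by auto
  then obtain u where "u \<in> V - {r}" "f u \<notin> V - {r}"
    using acyclic[unfolded acyclic_on_def, rule_format, OF subset_refl] by blast
  then have u: "u \<in> V - {r}" "f u = r"
    using range[of u] by auto
  then have "card (?C r) > 0"
    using fin by (auto simp: card_gt_0_iff)
  then have "z r * z r ^ (vdegree (parent_graph V r f) r - 1) = z r ^ card (?C r)"
    by (simp add: vdegree_parent_graph[OF root] flip: power_Suc)
  moreover have "(\<Prod>v\<in>V - {r}. z v ^ (vdegree (parent_graph V r f) v - 1)) = (\<Prod>v\<in>V - {r}. z v ^ card (?C v))"
    by (rule prod.cong) (simp_all add: vdegree_parent_graph)
  ultimately have "z r * (\<Prod>v\<in>V. z v ^ (vdegree (parent_graph V r f) v - 1)) = (\<Prod>v\<in>V. z v ^ card (?C v))"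
    by (simp add: prod.remove[OF fin root] mult.assoc[symmetric])
  also have "\<dots> = (\<Prod>v\<in>V. \<Prod>u\<in>?C v. z (f u))"
    by (rule prod.cong) auto
  also have "\<dots> = (\<Prod>u\<in>V - {r}. z (f u))"
    using fin range by (intro prod.group) auto
  finally show ?thesis .
qed

end

section \<open>Spanning trees correspond to acyclic parent functions\<close>

text \<open>If \<open>f v \<noteq> g v\<close>, the edge \<open>{v, f v}\<close> must be the parent
  edge of \<open>f v\<close> under \<open>g\<close>, so \<open>g (f v) = v\<close>. Since
  \<open>f\<close> has no 2-cycle, \<open>f\<close> and \<open>g\<close> differ at
  \<open>f v\<close> as well; hence the set of disagreement is invariant under \<open>f\<close> and
  so empty.\<close>

lemma parent_graph_inj:
  assumes "f \<in> PiE (V - {r}) T" "g \<in> PiE (V - {r}) T" "\<And>v. v \<in> V - {r} \<Longrightarrow> T v \<subseteq> V"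
    and "acyclic_on (V - {r}) f" "acyclic_on (V - {r}) g" "parent_graph V r f = parent_graph V r g"
  shows "f = g"
proof -
  have eq: "(\<lambda>v. {v, f v}) ` (V - {r}) = (\<lambda>v. {v, g v}) ` (V - {r})"
    using assms(6) by (simp add: parent_graph_def)
  have "{v \<in> V - {r}. f v \<noteq> g v} = {}"
  proof (rule acyclic_onD[OF assms(4)])
    show "f v \<in> {v \<in> V - {r}. f v \<noteq> g v}" if v: "v \<in> {v \<in> V - {r}. f v \<noteq> g v}" for v
    proof -
      have "{v, f v} \<in> (\<lambda>v. {v, g v}) ` (V - {r})"
        using v unfolding eq[symmetric] by blast
      then obtain w where w: "w \<in> V - {r}" "{v, f v} = {w, g w}"
        by blast
      then have "w = f v" "g (f v) = v"
        using v by (auto simp: doubleton_eq_iff)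
      then show ?thesis
        using w v acyclic_on_no_2_cycle[OF assms(4), of v "f v"] by auto
    qed
  qed auto
  then show ?thesis
    using assms(1,2) by (intro PiE_ext) auto
qed

text \<open>Let every vertex point to a neighbour in \<open>T\<close> that is closer to
  \<open>r\<close>; falling distances exclude cycles. The resulting parent graph is connected and
  lies in \<open>T\<close>, so a further edge of \<open>T\<close> would close a cycle.\<close>

lemma tree_is_parent_graph:
  assumes G: "finite_simple_graph G" and T: "T \<in> spanning_trees G" and r: "r \<in> verts G"
  shows "\<exists>f\<in>PiE (verts G - {r}) (neighborhood G). acyclic_on (verts G - {r}) f \<and>
    T = parent_graph (verts G) r f"
proof -
  let ?V = "verts G" and ?R = "{(a, b). {a, b} \<in> edges T}"
  have T: "verts T = ?V" "edges T \<subseteq> edges G" "connected_graph T" "\<nexists>c. graph_cycle T c"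
    using T by (auto simp: spanning_trees_def tree_graph_def)
  have edge: "e \<subseteq> ?V" "card e = 2" if "e \<in> edges T" for e
    using G T(2) that by (auto simp: finite_simple_graph_def)
  define d where "d v = (LEAST n. (v, r) \<in> ?R ^^ n)" for v
  have closer: "\<exists>u. {v, u} \<in> edges T \<and> d u < d v" if v: "v \<in> ?V - {r}" for v
  proof -
    have "(v, r) \<in> ?R\<^sup>*"
      using T(1,3) v r by (auto simp: connected_graph_def)
    then have "\<exists>n. (v, r) \<in> ?R ^^ n"
      by (simp add: rtrancl_power)
    then have dv: "(v, r) \<in> ?R ^^ d v"
      unfolding d_def by (rule LeastI_ex)
    then obtain n where n: "d v = Suc n"
      using v by (cases "d v") auto
    with dv obtain u where u: "(v, u) \<in> ?R" "(u, r) \<in> ?R ^^ n"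
      by (metis relpow_Suc_D2)
    then have "d u \<le> n"
      unfolding d_def by (intro Least_le)
    then show ?thesis using u n by auto
  qed
  define f where "f = (\<lambda>v\<in>?V - {r}. SOME u. {v, u} \<in> edges T \<and> d u < d v)"
  have f: "{v, f v} \<in> edges T" "d (f v) < d v" if "v \<in> ?V - {r}" for v
    using someI_ex[OF closer[OF that]] that by (auto simp: f_def)
  have fPi: "f \<in> PiE (?V - {r}) (neighborhood G)"
    using f(1) edge T(2) by (force simp: f_def PiE_iff neighborhood_def)
  have ac: "acyclic_on (?V - {r}) f"
  proof (rule acyclic_onI)
    fix S assume S: "S \<subseteq> ?V - {r}" "S \<noteq> {}" "\<And>v. v \<in> S \<Longrightarrow> f v \<in> S"
    then obtain w where "w \<in> S" by blast
    then obtain v where v: "v \<in> S" "\<And>u. u \<in> S \<Longrightarrow> d v \<le> d u"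
      using ex_has_least_nat[of "\<lambda>v. v \<in> S" w d] by blast
    have "d (f v) < d v"
      by (rule f(2)) (use v(1) S(1) in blast)
    moreover have "d v \<le> d (f v)"
      by (intro v(2) S(3) v(1))
    ultimately show False by simp
  qed
  have range: "f v \<in> ?V" if "v \<in> ?V - {r}" for v
    using f(1)[OF that] edge by auto
  have fin: "finite ?V"
    using G by (simp add: finite_simple_graph_def)
  let ?P = "parent_graph ?V r f"
  have "edges T \<subseteq> edges ?P"
  proof
    fix e assume e: "e \<in> edges T"
    then obtain u v where uv: "e = {u, v}" "u \<noteq> v"
      using edge(2)[OF e] by (auto simp: card_2_iff)
    show "e \<in> edges ?P"
    proof (rule ccontr)
      assume "e \<notin> edges ?P"
      have "(u, v) \<in> {(a, b). {a, b} \<in> edges ?P}\<^sup>*"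
        using connected_parent_graph[OF fin r range ac] edge(1)[OF e] uv
        by (auto simp: connected_graph_def parent_graph_def)
      then have "\<exists>c. graph_cycle T c"
        using e uv \<open>e \<notin> edges ?P\<close> f(1) edge(1) T(1)
        by (intro closing_edge_gives_cycle[of u v "edges ?P"]) (auto simp: parent_graph_def)
      then show False using T(4) by blast
    qed
  qed
  moreover have "edges ?P \<subseteq> edges T"
    using f(1) by (auto simp: parent_graph_def)
  ultimately have "T = ?P"
    using T(1) by (auto simp: parent_graph_def intro!: ugraph.equality)
  then show ?thesis using fPi ac by blast
qed

text \<open>\<open>parent_graph\<close> is a bijection and \<open>prod_degrees\<close> matches the
  weights. The weights \<open>z\<close> are arbitrary so that both the variables of the join and the
  substituted polynomials of the two given graphs can be inserted.\<close>

lemma rooted_enumerator: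
  fixes z :: "'a \<Rightarrow> 'r::comm_semiring_1"
  assumes G: "finite_simple_graph G" and r: "r \<in> verts G" and "2 \<le> card (verts G)"
  shows "z r * (\<Sum>T\<in>spanning_trees G. \<Prod>v\<in>verts G. z v ^ (vdegree T v - 1)) =
    (\<Sum>f\<in>PiE (verts G - {r}) (neighborhood G).
      if acyclic_on (verts G - {r}) f then \<Prod>v\<in>verts G - {r}. z (f v) else 0)"
proof -
  let ?V = "verts G"
  let ?F = "{f \<in> PiE (?V - {r}) (neighborhood G). acyclic_on (?V - {r}) f}"
  have fin: "finite ?V"
    using G by (simp add: finite_simple_graph_def)
  have nb: "neighborhood G v \<subseteq> ?V" for v
    by (auto simp: neighborhood_def)
  have range: "f v \<in> ?V" if "f \<in> ?F" "v \<in> ?V - {r}" for f v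
    using that nb by (auto dest!: PiE_mem)
  have "?V \<noteq> {r}"
    using assms(3) by auto
  have "bij_betw (parent_graph ?V r) ?F (spanning_trees G)"
    unfolding bij_betw_def
  proof
    show "inj_on (parent_graph ?V r) ?F"
      by (rule inj_onI) (use nb in \<open>auto intro: parent_graph_inj\<close>)
    show "parent_graph ?V r ` ?F = spanning_trees G"
    proof
      show "parent_graph ?V r ` ?F \<subseteq> spanning_trees G"
      proof
        fix T assume "T \<in> parent_graph ?V r ` ?F"
        then obtain f where f: "f \<in> ?F" "T = parent_graph ?V r f" by blast
        then have "tree_graph T"
          using range by (auto intro!: tree_parent_graph fin r)
        moreover have "edges T \<subseteq> edges G"
          using f by (auto simp: parent_graph_def neighborhood_def PiE_iff)
        ultimately show "T \<in> spanning_trees G"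
          using f by (simp add: spanning_trees_def parent_graph_def)
      qed
      show "spanning_trees G \<subseteq> parent_graph ?V r ` ?F"
        using tree_is_parent_graph[OF G _ r] by blast
    qed
  qed
  then have "z r * (\<Sum>T\<in>spanning_trees G. \<Prod>v\<in>?V. z v ^ (vdegree T v - 1)) =
      (\<Sum>f\<in>?F. z r * (\<Prod>v\<in>?V. z v ^ (vdegree (parent_graph ?V r f) v - 1)))"
    by (simp add: sum_distrib_left sum.reindex_bij_betw[symmetric])
  also have "\<dots> = (\<Sum>f\<in>?F. \<Prod>v\<in>?V - {r}. z (f v))"
    by (rule sum.cong[OF refl], rule prod_degrees[OF fin r]) (use range \<open>?V \<noteq> {r}\<close> in auto)
  also have "\<dots> = (\<Sum>f\<in>PiE (?V - {r}) (neighborhood G).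
      if acyclic_on (?V - {r}) f then \<Prod>v\<in>?V - {r}. z (f v) else 0)"
    using fin nb finite_subset[OF nb fin] by (intro sum.inter_filter finite_PiE) auto
  finally show ?thesis .
qed


section \<open>The neighborhood join\<close>

text \<open>An invariant set inside \<open>X\<close> contains no point of \<open>J\<close>, since
  those leave \<open>X\<close>. Conversely, an invariant set avoiding \<open>J\<close> meets
  \<open>X\<close> in an invariant set; if that part is empty, the set lies in
  \<open>Y\<close>.\<close>

lemma acyclic_on_Un_Diff:
  assumes "X \<inter> Y = {}" "J \<subseteq> X" "\<And>x. x \<in> J \<Longrightarrow> g x \<notin> X" "\<And>x. x \<in> X - J \<Longrightarrow> g x \<in> X"
  shows "acyclic_on (X \<union> Y - J) g \<longleftrightarrow> acyclic_on X g \<and> acyclic_on Y g"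
proof
  assume ac: "acyclic_on (X \<union> Y - J) g"
  have "acyclic_on X g"
  proof (rule acyclic_onI)
    fix S assume S: "S \<subseteq> X" "S \<noteq> {}" "\<And>v. v \<in> S \<Longrightarrow> g v \<in> S"
    have "S \<inter> J = {}"
      using S(1,3) assms(3) by blast
    then have "S = {}"
      using S by (intro acyclic_onD[OF ac]) auto
    then show False using S(2) by simp
  qed
  moreover have "acyclic_on Y g"
    using assms(1,2) by (intro acyclic_on_subset[OF ac]) auto
  ultimately show "acyclic_on X g \<and> acyclic_on Y g" ..
next
  assume ac: "acyclic_on X g \<and> acyclic_on Y g"
  show "acyclic_on (X \<union> Y - J) g"
  proof (rule acyclic_onI)
    fix S assume S: "S \<subseteq> X \<union> Y - J" "S \<noteq> {}" "\<And>v. v \<in> S \<Longrightarrow> g v \<in> S"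
    have "S \<inter> X = {}"
    proof (rule acyclic_onD)
      show "acyclic_on X g" using ac ..
      show "g v \<in> S \<inter> X" if "v \<in> S \<inter> X" for v
        using that S(1,3) assms(4)[of v] by auto
    qed auto
    then have "S = {}"
      using S ac by (intro acyclic_onD[of Y g S]) auto
    then show False using S(2) by simp
  qed
qed

lemma sum_acyclic_fibres:
  fixes z :: "'c \<Rightarrow> 'r::comm_semiring_1" and \<iota> :: "'a \<Rightarrow> 'c" and \<kappa> :: "'c \<Rightarrow> 'a"
  assumes "finite U" "\<And>v. v \<in> U \<Longrightarrow> finite (N v)" "\<And>u. finite (T u)"
    and nb: "\<And>v. v \<in> U \<Longrightarrow> nb (\<iota> v) = (\<Union>u\<in>N v. T u)"
    and T: "\<And>u. u \<in> U \<Longrightarrow> T u = {\<iota> u}" and \<kappa>: "\<And>u t. t \<in> T u \<Longrightarrow> \<kappa> t = u"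
  shows "(\<Sum>f\<in>PiE U N. if acyclic_on U f then \<Prod>v\<in>U. \<Sum>t\<in>T (f v). z t else 0) =
    (\<Sum>h\<in>PiE (\<iota> ` U) nb. if acyclic_on (\<iota> ` U) h then \<Prod>w\<in>\<iota> ` U. z (h w) else 0)"
proof -
  have \<kappa>\<iota>: "\<kappa> (\<iota> u) = u" if "u \<in> U" for u
    using \<kappa>[of "\<iota> u" u] T[OF that] by simp
  then have inj: "inj_on \<iota> U"
    by (rule inj_on_inverseI)
  let ?j = "\<lambda>(f, k). \<lambda>w\<in>\<iota> ` U. k (\<kappa> w)"
  let ?i = "\<lambda>h. (\<lambda>v\<in>U. \<kappa> (h (\<iota> v)), \<lambda>v\<in>U. h (\<iota> v))"
  have acyclic: "acyclic_on (\<iota> ` U) h \<longleftrightarrow> acyclic_on U f"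
    if h: "\<And>v. v \<in> U \<Longrightarrow> h (\<iota> v) \<in> T (f v)" for f :: "'a \<Rightarrow> 'a" and h :: "'c \<Rightarrow> 'c"
  proof -
    have closed: "h (\<iota> v) \<in> \<iota> ` S \<longleftrightarrow> f v \<in> S" if "v \<in> U" "S \<subseteq> U" for v S
    proof
      assume "h (\<iota> v) \<in> \<iota> ` S"
      then obtain s where "s \<in> S" "h (\<iota> v) = \<iota> s"
        by blast
      moreover from this have "\<kappa> (\<iota> s) = f v"
        using \<kappa>[OF h[OF that(1)]] by simp
      ultimately show "f v \<in> S"
        using \<kappa>\<iota>[of s] that(2) by auto
    next
      assume "f v \<in> S"
      then show "h (\<iota> v) \<in> \<iota> ` S"
        using h[OF that(1)] T[of "f v"] that(2) by auto
    qed
    show ?thesis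
      unfolding acyclic_on_def
    proof (intro iffI allI impI)
      fix S assume *: "\<forall>S\<subseteq>\<iota> ` U. S \<noteq> {} \<longrightarrow> (\<exists>v\<in>S. h v \<notin> S)" and S: "S \<subseteq> U" "S \<noteq> {}"
      then have "\<exists>v\<in>\<iota> ` S. h v \<notin> \<iota> ` S"
        by (intro *[rule_format]) auto
      then show "\<exists>v\<in>S. f v \<notin> S"
        using closed S by (auto simp: subset_iff)
    next
      fix S assume *: "\<forall>S\<subseteq>U. S \<noteq> {} \<longrightarrow> (\<exists>v\<in>S. f v \<notin> S)" and S: "S \<subseteq> \<iota> ` U" "S \<noteq> {}"
      then obtain S' where S': "S' \<subseteq> U" "S = \<iota> ` S'"
        by (meson subset_imageE)
      then have "\<exists>v\<in>S'. f v \<notin> S'"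
        using S by (intro *[rule_format]) auto
      then show "\<exists>v\<in>S. h v \<notin> S"
        using closed S' by (auto simp: subset_iff)
    qed
  qed
  have "(\<Sum>f\<in>PiE U N. if acyclic_on U f then \<Prod>v\<in>U. \<Sum>t\<in>T (f v). z t else 0) =
      (\<Sum>f\<in>PiE U N. \<Sum>k\<in>PiE U (\<lambda>v. T (f v)). if acyclic_on U f then \<Prod>v\<in>U. z (k v) else 0)"
    using assms(1,3) by (intro sum.cong refl) (simp add: prod_sum_PiE)
  also have "\<dots> = (\<Sum>(f, k)\<in>(SIGMA f:PiE U N. PiE U (\<lambda>v. T (f v))).
      if acyclic_on U f then \<Prod>v\<in>U. z (k v) else 0)"
    using assms(1-3) by (intro sum.Sigma ballI finite_PiE) auto
  also have "\<dots> = (\<Sum>h\<in>PiE (\<iota> ` U) nb. if acyclic_on (\<iota> ` U) h then \<Prod>w\<in>\<iota> ` U. z (h w) else 0)"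
  proof (rule sum.reindex_bij_witness[of _ ?i ?j])
    fix x assume x: "x \<in> (SIGMA f:PiE U N. PiE U (\<lambda>v. T (f v)))"
    then obtain f k where [simp]: "x = (f, k)" and f: "f \<in> PiE U N" and k: "k \<in> PiE U (\<lambda>v. T (f v))"
      by auto
    have fk: "\<kappa> (k v) = f v" if "v \<in> U" for v
      using \<kappa>[OF PiE_mem[OF k that]] .
    show "?i (?j x) = x"
      using f k by (auto simp: fk \<kappa>\<iota> fun_eq_iff PiE_iff extensional_def)
    show "?j x \<in> PiE (\<iota> ` U) nb"
      using PiE_mem[OF f] PiE_mem[OF k] by (force simp: \<kappa>\<iota> nb)
    have "acyclic_on (\<iota> ` U) (?j x) \<longleftrightarrow> acyclic_on U f"
      using k by (intro acyclic) (auto simp: \<kappa>\<iota>)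
    then show "(if acyclic_on (\<iota> ` U) (?j x) then \<Prod>w\<in>\<iota> ` U. z (?j x w) else 0) =
        (case x of (f, k) \<Rightarrow> if acyclic_on U f then \<Prod>v\<in>U. z (k v) else 0)"
      by (simp add: prod.reindex[OF inj] \<kappa>\<iota> cong: prod.cong)
  next
    fix h assume h: "h \<in> PiE (\<iota> ` U) nb"
    have *: "h (\<iota> v) \<in> T (\<kappa> (h (\<iota> v)))" "\<kappa> (h (\<iota> v)) \<in> N v" if "v \<in> U" for v
    proof -
      have "h (\<iota> v) \<in> (\<Union>u\<in>N v. T u)"
        using PiE_mem[OF h, of "\<iota> v"] that nb by auto
      then obtain u where "u \<in> N v" "h (\<iota> v) \<in> T u" by blast
      then show "h (\<iota> v) \<in> T (\<kappa> (h (\<iota> v)))" "\<kappa> (h (\<iota> v)) \<in> N v"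
        using \<kappa> by auto
    qed
    show "?j (?i h) = h"
      using h by (auto simp: \<kappa>\<iota> fun_eq_iff PiE_iff extensional_def)
    show "?i h \<in> (SIGMA f:PiE U N. PiE U (\<lambda>v. T (f v)))"
      using * by auto
  qed
  finally show ?thesis .
qed

section \<open>Neighborhoods in the join\<close>

lemma neighborhood_sym:
  assumes "u \<in> verts G"
  shows "v \<in> neighborhood G u \<Longrightarrow> u \<in> neighborhood G v"
  using assms by (simp add: neighborhood_def insert_commute)

lemma neighborhood_subset: "finite_simple_graph G \<Longrightarrow> neighborhood G v \<subseteq> verts G - {v}"
  by (auto simp: neighborhood_def finite_simple_graph_def)

lemma finite_neighborhood: "finite_simple_graph G \<Longrightarrow> finite (neighborhood G v)"
  by (simp add: neighborhood_def finite_simple_graph_def)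

text \<open>Take the first edge of a walk from \<open>v\<close> to another vertex. Nonemptiness is
  what allows the sums of variables to be cancelled.\<close>

lemma neighborhood_nonempty:
  assumes "connected_graph G" "v \<in> verts G" "2 \<le> card (verts G)" "finite_simple_graph G"
  shows "neighborhood G v \<noteq> {}"
proof -
  have "\<exists>u\<in>verts G. u \<noteq> v"
  proof (rule ccontr)
    assume "\<not> ?thesis"
    then have "verts G \<subseteq> {v}" by auto
    then have "card (verts G) \<le> 1"
      using card_mono[of "{v}"] by simp
    then show False using assms(3) by simp
  qed
  then obtain u where u: "u \<in> verts G" "u \<noteq> v" by blast
  then have "(v, u) \<in> {(a, b). {a, b} \<in> edges G}\<^sup>*"
    using assms(1,2) by (simp add: connected_graph_def)
  then obtain w where "{v, w} \<in> edges G"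
    using u(2) by (auto elim: converse_rtranclE)
  then have "w \<in> neighborhood G v"
    using assms(4) by (auto simp: neighborhood_def finite_simple_graph_def)
  then show ?thesis by blast
qed

lemma verts_neighborhood_join:
  "verts (neighborhood_join G\<^sub>1 v\<^sub>1 G\<^sub>2 v\<^sub>2) = Inl ` (verts G\<^sub>1 - {v\<^sub>1}) \<union> Inr ` (verts G\<^sub>2 - {v\<^sub>2})"
  by (auto simp: neighborhood_join_def add_edges_def remove_verts_def disjoint_union_def)

lemma doubleton_eq_image_Inl: "{Inl a, x} = Inl ` e \<longleftrightarrow> (\<exists>b. x = Inl b \<and> e = {a, b})"
proof
  assume *: "{Inl a, x} = Inl ` e"
  then obtain b where "x = Inl b" by blast
  moreover have "e = {a, b}"
    using * calculation by (auto simp: set_eq_iff image_iff)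
  ultimately show "\<exists>b. x = Inl b \<and> e = {a, b}" by blast
qed auto

lemma doubleton_eq_image_Inr: "{Inr a, x} = Inr ` e \<longleftrightarrow> (\<exists>b. x = Inr b \<and> e = {a, b})"
proof
  assume *: "{Inr a, x} = Inr ` e"
  then obtain b where "x = Inr b" by blast
  moreover have "e = {a, b}"
    using * calculation by (auto simp: set_eq_iff image_iff)
  ultimately show "\<exists>b. x = Inr b \<and> e = {a, b}" by blast
qed auto

lemma neighborhood_join_Inl:
  fixes G\<^sub>1 :: "'a ugraph" and G\<^sub>2 :: "'b ugraph"
  assumes "finite_simple_graph G\<^sub>2" "v \<in> verts G\<^sub>1 - {v\<^sub>1}"
  shows "neighborhood (neighborhood_join G\<^sub>1 v\<^sub>1 G\<^sub>2 v\<^sub>2) (Inl v) =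
    Inl ` (neighborhood G\<^sub>1 v - {v\<^sub>1}) \<union> (if v \<in> neighborhood G\<^sub>1 v\<^sub>1 then Inr ` neighborhood G\<^sub>2 v\<^sub>2 else {})"
  (is "?L = ?R")
proof -
  have "{Inl v, x} \<noteq> Inr ` e" for x and e :: "'b set" by blast
  then have "x \<in> ?L \<longleftrightarrow> x \<in> ?R" for x
    using assms neighborhood_subset[OF assms(1), of v\<^sub>2]
    by (cases x) (auto simp: neighborhood_join_def add_edges_def remove_verts_def disjoint_union_def
      neighborhood_def image_iff doubleton_eq_image_Inl doubleton_eq_iff)
  then show ?thesis by blast
qed

lemma neighborhood_join_Inr:
  fixes G\<^sub>1 :: "'a ugraph" and G\<^sub>2 :: "'b ugraph"
  assumes "finite_simple_graph G\<^sub>1" "v \<in> verts G\<^sub>2 - {v\<^sub>2}"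
  shows "neighborhood (neighborhood_join G\<^sub>1 v\<^sub>1 G\<^sub>2 v\<^sub>2) (Inr v) =
    Inr ` (neighborhood G\<^sub>2 v - {v\<^sub>2}) \<union> (if v \<in> neighborhood G\<^sub>2 v\<^sub>2 then Inl ` neighborhood G\<^sub>1 v\<^sub>1 else {})"
  (is "?L = ?R")
proof -
  have "{Inr v, x} \<noteq> Inl ` e" for x and e :: "'a set" by blast
  then have "x \<in> ?L \<longleftrightarrow> x \<in> ?R" for x
    using assms neighborhood_subset[OF assms(1), of v\<^sub>1]
    by (cases x) (auto simp: neighborhood_join_def add_edges_def remove_verts_def disjoint_union_def
      neighborhood_def image_iff doubleton_eq_image_Inr doubleton_eq_iff)
  then show ?thesis by blast
qed

text \<open>Rooting at the marked vertex \<open>r\<close> supplies the factor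
  \<open>\<sigma> r\<close>. Substituting the sum over \<open>Y\<close> for the variable of
  \<open>r\<close> lets each arrow into \<open>r\<close> end anywhere in \<open>Y\<close>, as arrows
  of the join do. Keeping \<iota> and \<open>Y\<close> abstract serves both factors.\<close>

lemma subst_enumerator_fibres:
  fixes G :: "'a ugraph" and \<sigma> :: "'a \<Rightarrow> 'c mpoly"
  assumes G: "finite_simple_graph G" and r: "r \<in> verts G" and "2 \<le> card (verts G)"
    and "finite Y" and \<kappa>: "\<And>u. \<kappa> (\<iota> u) = u" "\<And>y. y \<in> Y \<Longrightarrow> \<kappa> y = r"
    and nb: "\<And>v. v \<in> verts G - {r} \<Longrightarrow>
      nb (\<iota> v) = \<iota> ` (neighborhood G v - {r}) \<union> (if v \<in> neighborhood G r then Y else {})"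
    and \<sigma>: "\<And>u. \<sigma> u = (if u = r then \<Sum>y\<in>Y. mvar y else mvar (\<iota> u))"
  shows "(\<Sum>y\<in>Y. mvar y) * mpoly_subst \<sigma> (spanning_enumerator G) =
    (\<Sum>h\<in>PiE (\<iota> ` (verts G - {r})) nb. if acyclic_on (\<iota> ` (verts G - {r})) h
      then \<Prod>w\<in>\<iota> ` (verts G - {r}). mvar (h w) else 0)"
proof -
  let ?U = "verts G - {r}"
  define T where "T u = (if u = r then Y else {\<iota> u})" for u
  have fin: "finite (verts G)"
    using G by (simp add: finite_simple_graph_def)
  have "(\<Sum>y\<in>Y. mvar y) * mpoly_subst \<sigma> (spanning_enumerator G) =
      \<sigma> r * (\<Sum>T\<in>spanning_trees G. \<Prod>v\<in>verts G. \<sigma> v ^ (vdegree T v - 1))"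
    by (simp add: \<sigma>[of r] spanning_enumerator_def mpoly_subst_sum mpoly_subst_prod_mvar_power fin)
  also have "\<dots> = (\<Sum>f\<in>PiE ?U (neighborhood G). if acyclic_on ?U f then \<Prod>v\<in>?U. \<sigma> (f v) else 0)"
    by (rule rooted_enumerator[OF assms(1-3)])
  also have "\<dots> = (\<Sum>f\<in>PiE ?U (neighborhood G). if acyclic_on ?U f
      then \<Prod>v\<in>?U. \<Sum>t\<in>T (f v). mvar t else 0)"
    by (simp add: T_def \<sigma> if_distrib cong: if_cong)
  also have "\<dots> = (\<Sum>h\<in>PiE (\<iota> ` ?U) nb. if acyclic_on (\<iota> ` ?U) h then \<Prod>w\<in>\<iota> ` ?U. mvar (h w) else 0)"
  proof (rule sum_acyclic_fibres[where \<kappa> = \<kappa>])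
    fix v assume v: "v \<in> ?U"
    have "v \<in> neighborhood G r \<longleftrightarrow> r \<in> neighborhood G v"
      using r v by (auto intro: neighborhood_sym)
    then show "nb (\<iota> v) = (\<Union>u\<in>neighborhood G v. T u)"
      by (auto simp: nb[OF v] T_def split: if_splits)
  next
    fix u t assume "t \<in> T u"
    then show "\<kappa> t = u"
      by (auto simp: T_def \<kappa> split: if_splits)
  qed (use fin finite_neighborhood[OF G] assms(4) in \<open>auto simp: T_def\<close>)
  finally show ?thesis .
qed

theorem theorem5:
  fixes G\<^sub>1 :: "'a ugraph" and G\<^sub>2 :: "'b ugraph" and v\<^sub>1 :: 'a and v\<^sub>2 :: 'b
  assumes "finite_simple_graph G\<^sub>1" and "connected_graph G\<^sub>1" and "card (verts G\<^sub>1) \<ge> 2"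
    and "finite_simple_graph G\<^sub>2" and "connected_graph G\<^sub>2" and "card (verts G\<^sub>2) \<ge> 2"
    and "v\<^sub>1 \<in> verts G\<^sub>1" and "v\<^sub>2 \<in> verts G\<^sub>2"
  shows "spanning_enumerator (neighborhood_join G\<^sub>1 v\<^sub>1 G\<^sub>2 v\<^sub>2) =
     mpoly_subst (\<lambda>u. if u = v\<^sub>1 then \<Sum>i\<in>neighborhood G\<^sub>2 v\<^sub>2. mvar (Inr i) else mvar (Inl u))
       (spanning_enumerator G\<^sub>1) *
     mpoly_subst (\<lambda>u. if u = v\<^sub>2 then \<Sum>i\<in>neighborhood G\<^sub>1 v\<^sub>1. mvar (Inl i) else mvar (Inr u))
       (spanning_enumerator G\<^sub>2)"
    (is "?P = ?P\<^sub>1 * ?P\<^sub>2")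
proof -
  define H where "H = neighborhood_join G\<^sub>1 v\<^sub>1 G\<^sub>2 v\<^sub>2"
  define A :: "('a + 'b) set" where "A = Inl ` neighborhood G\<^sub>1 v\<^sub>1"
  define B :: "('a + 'b) set" where "B = Inr ` neighborhood G\<^sub>2 v\<^sub>2"
  define X :: "('a + 'b) set" where "X = Inl ` (verts G\<^sub>1 - {v\<^sub>1})"
  define Y :: "('a + 'b) set" where "Y = Inr ` (verts G\<^sub>2 - {v\<^sub>2})"
  let ?nb = "neighborhood H" and ?V = "verts H"
  have V: "?V = X \<union> Y" and XY: "X \<inter> Y = {}"
    by (auto simp: H_def X_def Y_def verts_neighborhood_join)
  have nb_Inl: "?nb (Inl v) = Inl ` (neighborhood G\<^sub>1 v - {v\<^sub>1}) \<union> (if v \<in> neighborhood G\<^sub>1 v\<^sub>1 then B else {})"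
    if "v \<in> verts G\<^sub>1 - {v\<^sub>1}" for v
    using neighborhood_join_Inl[OF assms(4) that] by (simp add: H_def B_def)
  have nb_Inr: "?nb (Inr v) = Inr ` (neighborhood G\<^sub>2 v - {v\<^sub>2}) \<union> (if v \<in> neighborhood G\<^sub>2 v\<^sub>2 then A else {})"
    if "v \<in> verts G\<^sub>2 - {v\<^sub>2}" for v
    using neighborhood_join_Inr[OF assms(1) that] by (simp add: H_def A_def)
  have H: "finite_simple_graph H"
    unfolding H_def using assms(1,4) by (rule finite_simple_graph_neighborhood_join)
  then have fin: "finite ?V" by (simp add: finite_simple_graph_def)
  have AX: "A \<subseteq> X" and BY: "B \<subseteq> Y"
    unfolding A_def B_def X_def Y_def using assms(1,4) by (intro image_mono neighborhood_subset; simp)+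
  have finAB: "finite A" "finite B"
    using assms(1,4) by (simp_all add: A_def B_def finite_neighborhood)
  have neAB: "A \<noteq> {}" "B \<noteq> {}"
    using assms by (simp_all add: A_def B_def neighborhood_nonempty)
  obtain a b where ab: "a \<in> A" "b \<in> B" using neAB by blast
  have card: "2 \<le> card ?V"
  proof -
    have "a \<noteq> b" "{a, b} \<subseteq> ?V" using ab AX BY XY V by auto
    then show ?thesis using card_mono[OF fin, of "{a, b}"] by simp
  qed
  let ?S\<^sub>A = "\<Sum>i\<in>A. mvar i" and ?S\<^sub>B = "\<Sum>i\<in>B. mvar i"
  have sum_A: "(\<Sum>i\<in>neighborhood G\<^sub>1 v\<^sub>1. mvar (Inl i)) = ?S\<^sub>A"
    unfolding A_def by (simp add: sum.reindex)
  have sum_B: "(\<Sum>i\<in>neighborhood G\<^sub>2 v\<^sub>2. mvar (Inr i)) = ?S\<^sub>B"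
    unfolding B_def by (simp add: sum.reindex)
  let ?W = "\<lambda>U h. if acyclic_on U h then \<Prod>w\<in>U. mvar (h w :: 'a + 'b) else 0"
  have P\<^sub>1: "?S\<^sub>B * ?P\<^sub>1 = (\<Sum>h\<in>PiE X ?nb. ?W X h)"
    unfolding sum_B X_def
    \<comment> \<open>The left inverse collapses the whole second summand, and with it
      \<open>B\<close>, to the marked vertex.\<close>
    by (rule subst_enumerator_fibres[where \<kappa> = "case_sum id (\<lambda>_. v\<^sub>1)"])
      (use assms(1,3,7) finAB(2) nb_Inl in \<open>auto simp: B_def\<close>)
  have P\<^sub>2: "?S\<^sub>A * ?P\<^sub>2 = (\<Sum>h\<in>PiE Y ?nb. ?W Y h)"
    unfolding sum_A Y_def
    by (rule subst_enumerator_fibres[where \<kappa> = "case_sum (\<lambda>_. v\<^sub>2) id"])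
      (use assms(4,6,8) finAB(1) nb_Inr in \<open>auto simp: A_def\<close>)
  have "?S\<^sub>A * (?S\<^sub>B * ?P) = (\<Sum>r\<in>A. ?S\<^sub>B * (mvar r * ?P))"
    unfolding sum_distrib_left[symmetric] sum_distrib_right[symmetric] by (rule mult.left_commute)
  also have "\<dots> = (\<Sum>r\<in>A. ?S\<^sub>B * (\<Sum>g\<in>PiE (?V - {r}) ?nb. ?W (?V - {r}) g))"
  proof (rule sum.cong[OF refl])
    fix r assume "r \<in> A"
    then have "r \<in> ?V" using AX V by auto
    then show "?S\<^sub>B * (mvar r * ?P) = ?S\<^sub>B * (\<Sum>g\<in>PiE (?V - {r}) ?nb. ?W (?V - {r}) g)"
      using rooted_enumerator[OF H _ card, of r mvar] by (simp add: H_def spanning_enumerator_def)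
  qed
  also have "\<dots> = (\<Sum>g\<in>PiE ?V ?nb. if acyclic_on (?V - {v \<in> A. g v \<in> B}) g then \<Prod>v\<in>?V. mvar (g v) else 0)"
  proof (rule sum_unicyclic[OF fin])
    \<comment> \<open>Here it enters that all edges between the two neighborhoods are added.\<close>
    show "B \<subseteq> ?nb v" if "v \<in> A" for v
    proof -
      obtain u where u: "v = Inl u" "u \<in> neighborhood G\<^sub>1 v\<^sub>1" "u \<in> verts G\<^sub>1 - {v\<^sub>1}"
        using \<open>v \<in> A\<close> AX by (auto simp: A_def X_def)
      show ?thesis
        unfolding u(1) nb_Inl[OF u(3)] using u(2) by simp
    qed
  qed (use ab AX BY V in \<open>auto simp: neighborhood_def\<close>)
  also have "\<dots> = (\<Sum>h\<in>PiE X ?nb. \<Sum>f\<in>PiE Y ?nb. ?W X h * ?W Y f)"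
    unfolding V sum_PiE_Un[OF XY]
  proof (intro sum.cong refl)
    fix h f assume h: "h \<in> PiE X ?nb" and f: "f \<in> PiE Y ?nb"
    define g where "g = (\<lambda>x. if x \<in> X then h x else f x)"
    have gX: "g x = h x" if "x \<in> X" for x using that by (simp add: g_def)
    have gY: "g x = f x" if "x \<in> Y" for x using that XY by (auto simp: g_def)
    \<comment> \<open>The only edges of \<open>H\<close> from \<open>X\<close> to \<open>Y\<close>
      run from \<open>A\<close> to \<open>B\<close>, so a vertex of \<open>X\<close> that does not
      jump stays in \<open>X\<close>. This makes acyclicity off the jumps split into one condition
      on each side.\<close>
    have inX: "g x \<in> X" if "x \<in> X - {v \<in> A. g v \<in> B}" for x
    proof -
      have x: "x \<in> X" "g x \<in> ?nb x"
        using that PiE_mem[OF h, of x] gX[of x] by auto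
      obtain v where v: "x = Inl v" "v \<in> verts G\<^sub>1 - {v\<^sub>1}"
        using x(1) by (auto simp: X_def)
      show ?thesis
        using x(2) that unfolding v(1) nb_Inl[OF v(2)]
        by (auto simp: A_def X_def neighborhood_def split: if_splits)
    qed
    have "acyclic_on (X \<union> Y - {v \<in> A. g v \<in> B}) g \<longleftrightarrow> acyclic_on X g \<and> acyclic_on Y g"
      by (rule acyclic_on_Un_Diff) (use XY AX BY inX in auto)
    also have "\<dots> \<longleftrightarrow> acyclic_on X h \<and> acyclic_on Y f"
      using acyclic_on_cong[of X g h] acyclic_on_cong[of Y g f] gX gY by blast
    finally have "acyclic_on (X \<union> Y - {v \<in> A. g v \<in> B}) g \<longleftrightarrow> acyclic_on X h \<and> acyclic_on Y f" .
    moreover have "(\<Prod>v\<in>X \<union> Y. mvar (g v)) = (\<Prod>v\<in>X. mvar (h v)) * (\<Prod>v\<in>Y. mvar (f v))"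
      using fin XY unfolding V by (subst prod.union_disjoint) (simp_all add: gX gY cong: prod.cong)
    ultimately show "(if acyclic_on (X \<union> Y - {v \<in> A. (if v \<in> X then h v else f v) \<in> B})
          (\<lambda>x. if x \<in> X then h x else f x)
        then \<Prod>v\<in>X \<union> Y. mvar (if v \<in> X then h v else f v) else 0) = ?W X h * ?W Y f"
      unfolding g_def by simp
  qed
  also have "\<dots> = (?S\<^sub>B * ?P\<^sub>1) * (?S\<^sub>A * ?P\<^sub>2)"
    unfolding P\<^sub>1 P\<^sub>2 by (rule sum_product[symmetric])
  also have "\<dots> = ?S\<^sub>A * (?S\<^sub>B * (?P\<^sub>1 * ?P\<^sub>2))"
    by (simp add: mult_ac)
  finally have "?S\<^sub>B * ?P = ?S\<^sub>B * (?P\<^sub>1 * ?P\<^sub>2)"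
    by (rule sum_mvar_mult_cancel[OF finAB(1) neAB(1)])
  then show ?thesis
    by (rule sum_mvar_mult_cancel[OF finAB(2) neAB(2)])
qed

end
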